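(* Let $n>2$ and $N>1$ be integers, let $V=(\mathbb C^n)^*$, and let $A_{nN}$ be the homogeneous coordinate ring of the image of the Veronese embedding $\mathbb P(V)\to\mathbb P(S^NV)$, $l\mapsto l^{\otimes N}$. Then the Courant algebroid $\mathcal V^{\rm poiss}(A_{nN})$ cannot be quantized, i.e. there is no vertex algebroid $\mathcal V$ whose associated graded Courant algebroid is isomorphic to $\mathcal V^{\rm poiss}(A_{nN})$.
   Context: All vector spaces are over $\mathbb C$; everything here is in homological degree $0$ (purely even). Equivalently, $A_{nN}=\oplus_{d\ge0}S^{Nd}(\mathbb C^n)=\mathbb C[V]^{\mathbb Z_N}$, where $\mathbb Z_N$ acts on $V$ by scalar $N$-th roots of unity. **Vertex algebra.** $(V,\mathbf 1,T,{}_{(n)},n\in\mathbb{Z})$ with $a_{(n)}b=0$ for $n\gg0$ and: (1) $\mathbf 1_{(n)}=\delta_{n,-1}{\rm Id}$, $a_{(-1)}\mathbf 1=a$; (2) $[T,a_{(n)}]b=(Ta)_{(n)}b=-na_{(n-1)}b$; (3) $a_{(n)}b=\sum_{j\ge0}(-1)^{n+1+j}\frac1{j!}T^j(b_{(n+j)}a)$; (4) $[a_{(m)},b_{(n)}]c=\sum_{j\ge0}\binom mj(a_{(j)}b)_{(m+n-j)}c$; (5) $(a_{(-1)}b)_{(n)}c=\sum_{j\ge0}a_{(-1-j)}b_{(n+j)}c+\sum_{j>0}b_{(n-j)}a_{(-1+j)}c$. **Vertex Poisson algebra.** $(V,\mathbf 1,T,{}_{(n)},n\ge-1)$ such that $(V,\mathbf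 1,T,{}_{(-1)})$ is a unital commutative associative algebra with derivation, (2)–(4) hold for $m,n\ge0$, and each ${}_{(n)}$, $n\ge0$, is a derivation of ${}_{(-1)}$. **Algebroids.** A vertex (resp. Courant) algebroid is a space $V_0\oplus V_1$ (conformal weights $0,1$) with $\mathbf 1\in V_0$, $T:V_0\to V_1$, products ${}_{(n)}:V_i\otimes V_j\to V_{i+j-n-1}$ for $n\ge0$ (zero if the target index is negative) and ${}_{(-1)}:(V_0\otimes V_i)\oplus(V_i\otimes V_0)\to V_i$, satisfying all those axioms of a vertex (resp. vertex Poisson) algebra that make sense, i.e. all of whose terms are defined by these operations or vanish for weight reasons. **Classical algebroid.** For a commutative algebra $A$, $\mathcal V^{\rm poiss}(A)=A\oplus({\rm Der}(A)\oplus\Omega(A))$ (weights $0$ and $1$; $\Omega(A)$ = Kähler differentials), $T=d$, with $a_{(-1)}b=ab$, $a_{(-1)}(\tau+\omega)=a\tau+a\omega$, $\tau_{(0)}a=\tau(a)$, $\tau_{(0)}\omega={\rm Lie}_\tau\omega$, $\tau_{(1)}\omega=\iota_\tau\omega$, $\tau_{(0)}\xi=[\tau,\xi]$, $\tau_{(1)}\xi=0$. **Quantization.** A vertex algebroid $\mathcal V=\mathcal V_0\oplus\mathcal V_1$ is filtered by $F^0=\mathcal V_0\oplus(\mathcal V_0)_{(-1)}T(\mathcal V_0)\subset F^1=\mathcal V$; taking symbols ($T$ and ${}_{(-1)}$ of filtration degree $0$, ${}_{(n)}$ with $n\ge0$ of filtration degree $-1$) makes ${\rm Gr}\,\mathcal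 V$ a Courant algebroid. A quantization of a Courant algebroid $\mathcal V^{\rm poiss}$ is a vertex algebroid $\mathcal V$ with an isomorphism of Courant algebroids ${\rm Gr}\,\mathcal V\cong\mathcal V^{\rm poiss}$. *)

theory Defs
  imports
    Complex_Main
    "HOL-Library.Multiset"
    "HOL-Library.Poly_Mapping"
    "HOL-Algebra.Module"
    "HOL-Algebra.QuotRing"
    "HOL-Algebra.Algebraic_Closure_Type"
begin

text \<open>
  Everything is linear over the field of complex numbers.  Vector spaces, modules and commutative
  algebras are carrier-based records of type \<^type>\<open>module\<close>; for objects that are only modules the
  fields \<^const>\<open>monoid.mult\<close> and \<^const>\<open>monoid.one\<close> of that record are never used.
\<close>

abbreviation CC :: "complex ring" where
  "CC \<equiv> ring_of_type_algebra"

definition span_mod :: "('r, 'p) ring_scheme \<Rightarrow> ('r, 'm, 'q) module_scheme \<Rightarrow> 'm set \<Rightarrow> 'm set" where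
  "span_mod R M S = \<Inter>{U. submodule U R M \<and> S \<subseteq> U}"

text \<open>
  The quotient of a module by a submodule.  For an algebra and an ideal of it, this is
  \<open>M Quot U\<close> together with the induced scalar multiplication.
\<close>

definition quot_mod :: "('r, 'm, 'q) module_scheme \<Rightarrow> 'm set \<Rightarrow> ('r, 'm set) module" where
  "quot_mod M U =
     \<lparr>carrier = a_rcosets\<^bsub>M\<^esub> U, monoid.mult = rcoset_mult M U, one = U +>\<^bsub>M\<^esub> \<one>\<^bsub>M\<^esub>,
      zero = U, add = set_add M, module.smult = (\<lambda>r C. \<Union>x\<in>C. U +>\<^bsub>M\<^esub> (r \<odot>\<^bsub>M\<^esub> x))\<rparr>"


section \<open>The homogeneous coordinate ring of the Veronese variety\<close>

text \<open>
  Monomials in the indeterminates \<open>'x\<close> are finite multisets of indeterminates (the free commutative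
  monoid, written additively), so polynomials are elements of \<open>'x multiset \<Rightarrow>\<^sub>0 complex\<close>, and the
  degree of a monomial is its size.
\<close>

definition poly_alg :: "'x set \<Rightarrow> (complex, 'x multiset \<Rightarrow>\<^sub>0 complex) module" where
  "poly_alg J =
     \<lparr>carrier = {p. \<forall>m\<in>Poly_Mapping.keys p. set_mset m \<subseteq> J}, monoid.mult = (*), one = 1,
      zero = 0, add = (+), module.smult = (\<lambda>c p. Poly_Mapping.single {#} c * p)\<rparr>"

definition poly_eval :: "('x \<Rightarrow> complex) \<Rightarrow> ('x multiset \<Rightarrow>\<^sub>0 complex) \<Rightarrow> complex" where
  "poly_eval v p =
     (\<Sum>m\<in>Poly_Mapping.keys p. Poly_Mapping.lookup p m * prod_mset (image_mset v m))"

definition homogeneous :: "('x multiset \<Rightarrow>\<^sub>0 complex) \<Rightarrow> bool" where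
  "homogeneous p \<longleftrightarrow> (\<exists>d. \<forall>m\<in>Poly_Mapping.keys p. size m = d)"

text \<open>
  \<open>Z\<close> is a set of homogeneous coordinate vectors representing the points of a subset of the
  projective space with coordinates indexed by \<open>J\<close>.
\<close>

definition homog_coord_ring ::
  "'x set \<Rightarrow> ('x \<Rightarrow> complex) set \<Rightarrow> (complex, ('x multiset \<Rightarrow>\<^sub>0 complex) set) module" where
  "homog_coord_ring J Z =
     quot_mod (poly_alg J)
       (Idl\<^bsub>poly_alg J\<^esub> {p \<in> carrier (poly_alg J). homogeneous p \<and> (\<forall>z\<in>Z. poly_eval z p = 0)})"

text \<open>
  The component of a symmetric tensor in \<open>S\<^sup>N V\<close> at an index tuple \<open>(i\<^sub>1, \<dots>, i\<^sub>N)\<close> depends only on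
  the multiset of these indices.  So the linear coordinates on \<open>S\<^sup>N V\<close> are indexed by the multisets
  of size \<open>N\<close> over \<open>{..<n}\<close>, and the coordinate of the \<open>N\<close>-fold tensor power of \<open>l\<close> at \<open>M\<close> is the
  product of the \<open>l i\<close>, \<open>i \<in># M\<close>.
\<close>

definition veronese_coords :: "nat \<Rightarrow> nat \<Rightarrow> nat multiset set" where
  "veronese_coords n N = {M. size M = N \<and> set_mset M \<subseteq> {..<n}}"

definition veronese_image :: "nat \<Rightarrow> (nat multiset \<Rightarrow> complex) set" where
  "veronese_image n = {\<lambda>M. prod_mset (image_mset l M) | l. \<exists>i<n. l i \<noteq> 0}"

definition veronese_ring ::
  "nat \<Rightarrow> nat \<Rightarrow> (complex, (nat multiset multiset \<Rightarrow>\<^sub>0 complex) set) module" where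
  "veronese_ring n N = homog_coord_ring (veronese_coords n N) (veronese_image n)"


section \<open>Derivations and Kaehler differentials\<close>

text \<open>A map defined on \<open>carrier A\<close> is represented by the function that is zero elsewhere.\<close>

definition derivations :: "(complex, 'a) module \<Rightarrow> ('a \<Rightarrow> 'a) set" where
  "derivations A =
     {\<tau>. \<tau> \<in> carrier A \<rightarrow> carrier A \<and> (\<forall>x. x \<notin> carrier A \<longrightarrow> \<tau> x = \<zero>\<^bsub>A\<^esub>) \<and>
        (\<forall>x\<in>carrier A. \<forall>y\<in>carrier A. \<tau> (x \<oplus>\<^bsub>A\<^esub> y) = \<tau> x \<oplus>\<^bsub>A\<^esub> \<tau> y) \<and>
        (\<forall>c. \<forall>x\<in>carrier A. \<tau> (c \<odot>\<^bsub>A\<^esub> x) = c \<odot>\<^bsub>A\<^esub> \<tau> x) \<and>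
        (\<forall>x\<in>carrier A. \<forall>y\<in>carrier A.
           \<tau> (x \<otimes>\<^bsub>A\<^esub> y) = (x \<otimes>\<^bsub>A\<^esub> \<tau> y) \<oplus>\<^bsub>A\<^esub> (y \<otimes>\<^bsub>A\<^esub> \<tau> x))}"

text \<open>The free \<open>A\<close>-module on the set \<open>carrier A\<close>, and its basis.\<close>

definition free_mod :: "(complex, 'a) module \<Rightarrow> ('a, 'a \<Rightarrow> 'a) module" where
  "free_mod A =
     \<lparr>carrier = {f. range f \<subseteq> carrier A \<and> (\<forall>x. x \<notin> carrier A \<longrightarrow> f x = \<zero>\<^bsub>A\<^esub>) \<and>
                    finite {x. f x \<noteq> \<zero>\<^bsub>A\<^esub>}},
      monoid.mult = undefined, one = undefined, zero = (\<lambda>_. \<zero>\<^bsub>A\<^esub>),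
      add = (\<lambda>f g x. f x \<oplus>\<^bsub>A\<^esub> g x), module.smult = (\<lambda>a f x. a \<otimes>\<^bsub>A\<^esub> f x)\<rparr>"

definition free_gen :: "(complex, 'a) module \<Rightarrow> 'a \<Rightarrow> 'a \<Rightarrow> 'a" where
  "free_gen A x = (\<lambda>y. if y = x then \<one>\<^bsub>A\<^esub> else \<zero>\<^bsub>A\<^esub>)"

definition kaehler_rels :: "(complex, 'a) module \<Rightarrow> ('a \<Rightarrow> 'a) set" where
  "kaehler_rels A = (let F = free_mod A; e = free_gen A in
     {e (x \<oplus>\<^bsub>A\<^esub> y) \<ominus>\<^bsub>F\<^esub> (e x \<oplus>\<^bsub>F\<^esub> e y) | x y. x \<in> carrier A \<and> y \<in> carrier A} \<union>
     {e (c \<odot>\<^bsub>A\<^esub> x) \<ominus>\<^bsub>F\<^esub> ((c \<odot>\<^bsub>A\<^esub> \<one>\<^bsub>A\<^esub>) \<odot>\<^bsub>F\<^esub> e x) | c x. x \<in> carrier A} \<union>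
     {e (x \<otimes>\<^bsub>A\<^esub> y) \<ominus>\<^bsub>F\<^esub> ((x \<odot>\<^bsub>F\<^esub> e y) \<oplus>\<^bsub>F\<^esub> (y \<odot>\<^bsub>F\<^esub> e x)) | x y.
        x \<in> carrier A \<and> y \<in> carrier A})"

definition kaehler :: "(complex, 'a) module \<Rightarrow> ('a, ('a \<Rightarrow> 'a) set) module" where
  "kaehler A = quot_mod (free_mod A) (span_mod A (free_mod A) (kaehler_rels A))"

definition kd :: "(complex, 'a) module \<Rightarrow> 'a \<Rightarrow> ('a \<Rightarrow> 'a) set" where
  "kd A x = span_mod A (free_mod A) (kaehler_rels A) +>\<^bsub>free_mod A\<^esub> free_gen A x"

text \<open>
  A differential \<open>\<omega>\<close> is a coset, and each \<open>f \<in> \<omega>\<close> is a way to write it as the sum of the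
  \<open>f x \<odot> kd A x\<close>.  The values below do not depend on the choice of \<open>f\<close>.
\<close>

definition contraction :: "(complex, 'a) module \<Rightarrow> ('a \<Rightarrow> 'a) \<Rightarrow> ('a \<Rightarrow> 'a) set \<Rightarrow> 'a" where
  "contraction A \<tau> \<omega> = (let f = (SOME f. f \<in> \<omega>) in
     \<Oplus>\<^bsub>A\<^esub>x\<in>{x. f x \<noteq> \<zero>\<^bsub>A\<^esub>}. f x \<otimes>\<^bsub>A\<^esub> \<tau> x)"

definition lie_deriv ::
  "(complex, 'a) module \<Rightarrow> ('a \<Rightarrow> 'a) \<Rightarrow> ('a \<Rightarrow> 'a) set \<Rightarrow> ('a \<Rightarrow> 'a) set" where
  "lie_deriv A \<tau> \<omega> = (let f = (SOME f. f \<in> \<omega>); \<Omega> = kaehler A in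
     \<Oplus>\<^bsub>\<Omega>\<^esub>x\<in>{x. f x \<noteq> \<zero>\<^bsub>A\<^esub>}. (\<tau> (f x) \<odot>\<^bsub>\<Omega>\<^esub> kd A x) \<oplus>\<^bsub>\<Omega>\<^esub> (f x \<odot>\<^bsub>\<Omega>\<^esub> kd A (\<tau> x)))"


section \<open>Vertex algebroids\<close>

text \<open>
  The data of a vertex or Courant algebroid: a graded vector space, the vacuum vector, the operator
  \<open>T\<close>, and the products \<open>nprod V n a b = a\<^sub>(\<^sub>n\<^sub>) b\<close>.  Only the values of \<open>T\<close> on weight 0, and those
  of \<open>nprod V n\<close> for \<open>n \<ge> -1\<close> on homogeneous pairs of total weight at most 1 if \<open>n = -1\<close>, are
  relevant.
\<close>

record 'v algebroid = "(complex, 'v) module" +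
  wt :: "int \<Rightarrow> 'v set"
  vac :: 'v
  transl :: "'v \<Rightarrow> 'v"
  nprod :: "int \<Rightarrow> 'v \<Rightarrow> 'v \<Rightarrow> 'v"

text \<open>
  The element \<open>a\<^sub>(\<^sub>n\<^sub>) b\<close> in the vertex algebra axioms.  By the axiom \<open>(T a)\<^sub>(\<^sub>n\<^sub>) b = -n a\<^sub>(\<^sub>n\<^sub>-\<^sub>1\<^sub>) b\<close>,
  the product with \<open>n = -2\<close> of two elements of weight 0 is determined by the data, namely as
  \<open>(T a)\<^sub>(\<^sub>-\<^sub>1\<^sub>) b\<close>.  With this, \<open>a\<^sub>(\<^sub>n\<^sub>) b\<close> is available for all \<open>a, b\<close> of weights \<open>i, j \<in> {0, 1}\<close> and
  all \<open>n\<close> for which its weight \<open>i + j - n - 1\<close> is at most 1.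
\<close>

definition mode :: "'v algebroid \<Rightarrow> int \<Rightarrow> 'v \<Rightarrow> 'v \<Rightarrow> 'v" where
  "mode V n a b = (if n = -2 then nprod V (-1) (transl V a) b else nprod V n a b)"

text \<open>
  The axioms of a vertex algebra are required of homogeneous elements whenever each of the terms,
  subterms included, has weight at most 1; those of negative weight are zero.  The side conditions
  on the weights express this, where it is not automatic, and the index sets of the sums leave out
  exactly terms that vanish since they contain a product of negative weight.  The two equations of
  \<open>[T, a\<^sub>(\<^sub>n\<^sub>)] b = (T a)\<^sub>(\<^sub>n\<^sub>) b = -n a\<^sub>(\<^sub>n\<^sub>-\<^sub>1\<^sub>) b\<close> are imposed separately: the commutator makes sense for
  \<open>b\<close> of weight 0, and \<open>(T a)\<^sub>(\<^sub>n\<^sub>) b\<close> for \<open>a\<close> of weight 0.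
\<close>

locale vertex_algebroid = module CC V for V :: "'v algebroid" (structure) +
  assumes wt_submodule: "\<And>i. i \<in> {0, 1} \<Longrightarrow> submodule (wt V i) CC V"
    and wt_zero: "\<And>i. i \<notin> {0, 1} \<Longrightarrow> wt V i = {\<zero>}"
    and wt_sum: "carrier V = wt V 0 <+>\<^bsub>V\<^esub> wt V 1"
    and wt_direct: "wt V 0 \<inter> wt V 1 = {\<zero>}"
    and vac_wt: "vac V \<in> wt V 0"
    and transl_wt: "\<And>a. a \<in> wt V 0 \<Longrightarrow> transl V a \<in> wt V 1"
    and transl_add: "\<And>a b. \<lbrakk>a \<in> wt V 0; b \<in> wt V 0\<rbrakk> \<Longrightarrow> transl V (a \<oplus> b) = transl V a \<oplus> transl V b"
    and transl_smult: "\<And>c a. a \<in> wt V 0 \<Longrightarrow> transl V (c \<odot> a) = c \<odot> transl V a"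
    and nprod_wt: "\<And>n i j a b. \<lbrakk>n \<ge> -1; i \<in> {0, 1}; j \<in> {0, 1}; i + j - n - 1 \<le> 1;
        a \<in> wt V i; b \<in> wt V j\<rbrakk> \<Longrightarrow> nprod V n a b \<in> wt V (i + j - n - 1)"
    and nprod_add_left: "\<And>n i j a a' b. \<lbrakk>n \<ge> -1; i \<in> {0, 1}; j \<in> {0, 1}; i + j - n - 1 \<le> 1;
        a \<in> wt V i; a' \<in> wt V i; b \<in> wt V j\<rbrakk>
        \<Longrightarrow> nprod V n (a \<oplus> a') b = nprod V n a b \<oplus> nprod V n a' b"
    and nprod_add_right: "\<And>n i j a b b'. \<lbrakk>n \<ge> -1; i \<in> {0, 1}; j \<in> {0, 1}; i + j - n - 1 \<le> 1;
        a \<in> wt V i; b \<in> wt V j; b' \<in> wt V j\<rbrakk>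
        \<Longrightarrow> nprod V n a (b \<oplus> b') = nprod V n a b \<oplus> nprod V n a b'"
    and nprod_smult_left: "\<And>n i j c a b. \<lbrakk>n \<ge> -1; i \<in> {0, 1}; j \<in> {0, 1}; i + j - n - 1 \<le> 1;
        a \<in> wt V i; b \<in> wt V j\<rbrakk> \<Longrightarrow> nprod V n (c \<odot> a) b = c \<odot> nprod V n a b"
    and nprod_smult_right: "\<And>n i j c a b. \<lbrakk>n \<ge> -1; i \<in> {0, 1}; j \<in> {0, 1}; i + j - n - 1 \<le> 1;
        a \<in> wt V i; b \<in> wt V j\<rbrakk> \<Longrightarrow> nprod V n a (c \<odot> b) = c \<odot> nprod V n a b"
    and vac_left: "\<And>n i a. \<lbrakk>i \<in> {0, 1}; i - n - 1 \<le> 1; a \<in> wt V i\<rbrakk>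
        \<Longrightarrow> mode V n (vac V) a = (if n = -1 then a else \<zero>)"
    and vac_right: "\<And>i a. \<lbrakk>i \<in> {0, 1}; a \<in> wt V i\<rbrakk> \<Longrightarrow> mode V (-1) a (vac V) = a"
    and transl_mode: "\<And>n j a b. \<lbrakk>j \<in> {0, 1}; 1 + j - n - 1 \<le> 1; a \<in> wt V 0; b \<in> wt V j\<rbrakk>
        \<Longrightarrow> mode V n (transl V a) b = of_int (- n) \<odot> mode V (n - 1) a b"
    and transl_comm: "\<And>n i a b. \<lbrakk>i \<in> {0, 1}; i + 1 - n - 1 \<le> 1; a \<in> wt V i; b \<in> wt V 0\<rbrakk>
        \<Longrightarrow> transl V (mode V n a b) \<ominus> mode V n a (transl V b) = of_int (- n) \<odot> mode V (n - 1) a b"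
    and skew: "\<And>n i j a b. \<lbrakk>i \<in> {0, 1}; j \<in> {0, 1}; i + j - n - 1 \<le> 1; a \<in> wt V i; b \<in> wt V j\<rbrakk>
        \<Longrightarrow> mode V n a b =
          (\<Oplus>l\<in>{l :: nat. int l \<le> i + j - n - 1}.
             ((-1) powi (n + 1 + int l) / fact l) \<odot> (transl V ^^ l) (mode V (n + int l) b a))"
    and commutator: "\<And>m n i j k a b c. \<lbrakk>i \<in> {0, 1}; j \<in> {0, 1}; k \<in> {0, 1};
        a \<in> wt V i; b \<in> wt V j; c \<in> wt V k;
        j + k - n - 1 \<le> 1; i + k - m - 1 \<le> 1; i + j + k - m - n - 2 \<le> 1\<rbrakk>
        \<Longrightarrow> mode V m a (mode V n b c) \<ominus> mode V n b (mode V m a c) =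
          (\<Oplus>l\<in>{l :: nat. int l \<le> i + j - 1}.
             (of_int m gchoose l) \<odot> mode V (m + n - int l) (mode V (int l) a b) c)"
    and normal_ordered: "\<And>n i j k a b c. \<lbrakk>i \<in> {0, 1}; j \<in> {0, 1}; k \<in> {0, 1};
        a \<in> wt V i; b \<in> wt V j; c \<in> wt V k; i + j \<le> 1; i + j + k - n - 1 \<le> 1\<rbrakk>
        \<Longrightarrow> mode V n (mode V (-1) a b) c =
          (\<Oplus>l\<in>{l :: nat. int l \<le> j + k - n - 1}. mode V (-1 - int l) a (mode V (n + int l) b c)) \<oplus>
          (\<Oplus>l\<in>{l :: nat. 0 < l \<and> int l \<le> i + k}. mode V (n - int l) b (mode V (-1 + int l) a c))"


section \<open>The associated graded Courant algebroid\<close>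

text \<open>The weight 1 part of \<open>F\<^sup>0\<close>; the weight 0 part is all of \<open>wt V 0\<close>.\<close>

definition filt0 :: "'v algebroid \<Rightarrow> 'v set" where
  "filt0 V = span_mod CC V {nprod V (-1) a (transl V b) | a b. a \<in> wt V 0 \<and> b \<in> wt V 0}"

text \<open>
  An element of the associated graded space is a triple of its component of weight 0 (which is of
  filtration degree 0), its component of weight 1 and filtration degree 0, and its component of
  weight 1 and filtration degree 1, a coset of \<open>filt0 V\<close>.  The products are the symbols of those of
  \<open>V\<close>, computed with representatives \<open>x\<close> and \<open>y\<close> of the cosets.
\<close>

definition gr :: "'v algebroid \<Rightarrow> ('v \<times> 'v \<times> 'v set) algebroid" where
  "gr V = (let F = filt0 V; o1 = \<zero>\<^bsub>V\<^esub>; Q = quot_mod V F; Q1 = (\<lambda>x. F +>\<^bsub>V\<^esub> x) ` wt V 1 in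
     \<lparr>carrier = wt V 0 \<times> F \<times> Q1,
      monoid.mult = undefined, one = undefined, zero = (o1, o1, F),
      add = (\<lambda>(a, \<omega>, C) (b, \<eta>, D). (a \<oplus>\<^bsub>V\<^esub> b, \<omega> \<oplus>\<^bsub>V\<^esub> \<eta>, C \<oplus>\<^bsub>Q\<^esub> D)),
      module.smult = (\<lambda>c (a, \<omega>, C). (c \<odot>\<^bsub>V\<^esub> a, c \<odot>\<^bsub>V\<^esub> \<omega>, c \<odot>\<^bsub>Q\<^esub> C)),
      wt = (\<lambda>k. if k = 0 then wt V 0 \<times> {o1} \<times> {F}
                else if k = 1 then {o1} \<times> F \<times> Q1
                else {(o1, o1, F)}),
      vac = (vac V, o1, F),
      transl = (\<lambda>(a, \<omega>, C). (o1, transl V a, F)),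
      nprod = (\<lambda>n (a, \<omega>, C) (b, \<eta>, D).
        let x = (SOME x. x \<in> C); y = (SOME y. y \<in> D); p = nprod V n in
        if n = -1 then (p a b, p a \<eta> \<oplus>\<^bsub>V\<^esub> p \<omega> b, F +>\<^bsub>V\<^esub> (p a y \<oplus>\<^bsub>V\<^esub> p x b))
        else if n = 0 then (p a y \<oplus>\<^bsub>V\<^esub> p x b, p x \<eta> \<oplus>\<^bsub>V\<^esub> p \<omega> y, F +>\<^bsub>V\<^esub> p x y)
        else if n = 1 then (p x \<eta> \<oplus>\<^bsub>V\<^esub> p \<omega> y, o1, F)
        else (o1, o1, F))\<rparr>)"


section \<open>The Courant algebroid of a commutative algebra and its quantizations\<close>

text \<open>
  The products not given by the usual formulas for \<open>\<tau>\<^sub>(\<^sub>n\<^sub>)\<close> follow by skew-symmetry; in particular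
  \<open>\<omega>\<^sub>(\<^sub>0\<^sub>) \<xi> = - \<xi>\<^sub>(\<^sub>0\<^sub>) \<omega> + T (\<xi>\<^sub>(\<^sub>1\<^sub>) \<omega>)\<close>.
\<close>

definition courant_of :: "(complex, 'a) module \<Rightarrow> ('a \<times> ('a \<Rightarrow> 'a) \<times> ('a \<Rightarrow> 'a) set) algebroid" where
  "courant_of A = (let \<Omega> = kaehler A; o0 = \<zero>\<^bsub>A\<^esub>; oD = (\<lambda>_. \<zero>\<^bsub>A\<^esub>); o\<Omega> = \<zero>\<^bsub>\<Omega>\<^esub> in
     \<lparr>carrier = carrier A \<times> derivations A \<times> carrier \<Omega>,
      monoid.mult = undefined, one = undefined, zero = (o0, oD, o\<Omega>),
      add = (\<lambda>(a, \<tau>, \<omega>) (b, \<xi>, \<eta>). (a \<oplus>\<^bsub>A\<^esub> b, \<lambda>x. \<tau> x \<oplus>\<^bsub>A\<^esub> \<xi> x, \<omega> \<oplus>\<^bsub>\<Omega>\<^esub> \<eta>)),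
      module.smult = (\<lambda>c (a, \<tau>, \<omega>). (c \<odot>\<^bsub>A\<^esub> a, \<lambda>x. c \<odot>\<^bsub>A\<^esub> \<tau> x, (c \<odot>\<^bsub>A\<^esub> \<one>\<^bsub>A\<^esub>) \<odot>\<^bsub>\<Omega>\<^esub> \<omega>)),
      wt = (\<lambda>k. if k = 0 then carrier A \<times> {oD} \<times> {o\<Omega>}
                else if k = 1 then {o0} \<times> derivations A \<times> carrier \<Omega>
                else {(o0, oD, o\<Omega>)}),
      vac = (\<one>\<^bsub>A\<^esub>, oD, o\<Omega>),
      transl = (\<lambda>(a, \<tau>, \<omega>). (o0, oD, kd A a)),
      nprod = (\<lambda>n (a, \<tau>, \<omega>) (b, \<xi>, \<eta>).
        if n = -1 then
          (a \<otimes>\<^bsub>A\<^esub> b, \<lambda>x. (a \<otimes>\<^bsub>A\<^esub> \<xi> x) \<oplus>\<^bsub>A\<^esub> (b \<otimes>\<^bsub>A\<^esub> \<tau> x), (a \<odot>\<^bsub>\<Omega>\<^esub> \<eta>) \<oplus>\<^bsub>\<Omega>\<^esub> (b \<odot>\<^bsub>\<Omega>\<^esub> \<omega>))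
        else if n = 0 then
          (\<tau> b \<ominus>\<^bsub>A\<^esub> \<xi> a, \<lambda>x. \<tau> (\<xi> x) \<ominus>\<^bsub>A\<^esub> \<xi> (\<tau> x),
           (lie_deriv A \<tau> \<eta> \<ominus>\<^bsub>\<Omega>\<^esub> lie_deriv A \<xi> \<omega>) \<oplus>\<^bsub>\<Omega>\<^esub> kd A (contraction A \<xi> \<omega>))
        else if n = 1 then (contraction A \<tau> \<eta> \<oplus>\<^bsub>A\<^esub> contraction A \<xi> \<omega>, oD, o\<Omega>)
        else (o0, oD, o\<Omega>))\<rparr>)"

definition algebroid_iso :: "'v algebroid \<Rightarrow> 'w algebroid \<Rightarrow> ('v \<Rightarrow> 'w) \<Rightarrow> bool" where
  "algebroid_iso V W \<phi> \<longleftrightarrow>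
     bij_betw \<phi> (carrier V) (carrier W) \<and>
     (\<forall>a\<in>carrier V. \<forall>b\<in>carrier V. \<phi> (a \<oplus>\<^bsub>V\<^esub> b) = \<phi> a \<oplus>\<^bsub>W\<^esub> \<phi> b) \<and>
     (\<forall>c. \<forall>a\<in>carrier V. \<phi> (c \<odot>\<^bsub>V\<^esub> a) = c \<odot>\<^bsub>W\<^esub> \<phi> a) \<and>
     (\<forall>i\<in>{0, 1}. \<phi> ` wt V i = wt W i) \<and>
     \<phi> (vac V) = vac W \<and>
     (\<forall>a\<in>wt V 0. \<phi> (transl V a) = transl W (\<phi> a)) \<and>
     (\<forall>n i j a b. n \<ge> -1 \<and> i \<in> {0, 1} \<and> j \<in> {0, 1} \<and> i + j - n - 1 \<le> 1 \<and>
        a \<in> wt V i \<and> b \<in> wt V j \<longrightarrow> \<phi> (nprod V n a b) = nprod W n (\<phi> a) (\<phi> b))"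

definition is_quantization :: "'v algebroid \<Rightarrow> 'w algebroid \<Rightarrow> bool" where
  "is_quantization V P \<longleftrightarrow> vertex_algebroid V \<and> (\<exists>\<phi>. algebroid_iso (gr V) P \<phi>)"

end

theory Submission
  imports Defs
begin

text \<open>
  The coordinate ring \<open>A\<close> is the ring of polynomials in \<open>x\<^sub>0, \<dots>, x\<^sub>n\<^sub>-\<^sub>1\<close> all of whose degrees are
  divisible by \<open>N\<close>.  The vector fields \<open>x\<^sub>i \<partial>\<^sub>k\<close> act on it, and over \<open>A\<close> they satisfy relations, such as
  \<open>f \<cdot> x\<^sub>0\<partial>\<^sub>2 = g \<cdot> x\<^sub>1\<partial>\<^sub>2\<close> with \<open>f = x\<^sub>1 x\<^sub>2\<^bsup>N-1\<^esup>\<close> and \<open>g = x\<^sub>0 x\<^sub>2\<^bsup>N-1\<^esup>\<close>.  A quantization would have to lift such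
  a relation up to an element of \<open>F\<^sup>0\<close>, that is, up to a Kaehler differential of \<open>A\<close>, and there are too
  few of those: in the lowest degree \<open>N\<close>, they are all exact.

  Concretely, let \<open>s\<close> and \<open>t\<close> be lifts of \<open>x\<^sub>0\<partial>\<^sub>2\<close> and \<open>x\<^sub>1\<partial>\<^sub>2\<close> to the weight 1 part of a quantization, and
  let \<open>w = f\<^sub>(\<^sub>-\<^sub>1\<^sub>) s - g\<^sub>(\<^sub>-\<^sub>1\<^sub>) t\<close>.  Then \<open>w\<close> acts trivially on \<open>A\<close>, hence lies in \<open>F\<^sup>0\<close>
  (\<open>acts_trivially_imp_exact\<close>), say \<open>w = \<Sum> a T(b)\<close>.  For every lift \<open>d\<close> of a derivation \<open>D\<close> this gives
  \<open>d\<^sub>(\<^sub>1\<^sub>) w = \<Sum> a D(b)\<close>.  On the other hand \<open>d\<^sub>(\<^sub>1\<^sub>)\<close> is not linear over \<open>A\<close> (\<open>one_mode_mult\<close>), and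

    \<open>d\<^sub>(\<^sub>1\<^sub>) w = f \<cdot> d\<^sub>(\<^sub>1\<^sub>) s - g \<cdot> d\<^sub>(\<^sub>1\<^sub>) t - x\<^sub>0\<partial>\<^sub>2(D f) + x\<^sub>1\<partial>\<^sub>2(D g)\<close>.

  Now look at the coefficient of the monomial \<open>M = x\<^sub>0 x\<^sub>1 x\<^sub>2\<^bsup>N-2\<^esup>\<close>, which has the lowest positive degree
  occurring in \<open>A\<close>.  The derivations \<open>D = x\<^sub>1\<partial>\<^sub>1\<close> and \<open>D = x\<^sub>0\<partial>\<^sub>0\<close> both multiply \<open>M\<close> by 1 and have no
  constant terms in their values, so they give the same coefficient of \<open>M\<close> in \<open>\<Sum> a D(b)\<close>.  The terms
  with \<open>d\<^sub>(\<^sub>1\<^sub>) s\<close> and \<open>d\<^sub>(\<^sub>1\<^sub>) t\<close>, which depend on the choice of the lifts, do not contribute to this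
  coefficient, since \<open>f\<close> and \<open>g\<close> are monomials of the degree of \<open>M\<close> other than \<open>M\<close>.  But the remaining
  terms contribute \<open>-(N-1)\<close> for \<open>x\<^sub>1\<partial>\<^sub>1\<close> and \<open>N-1\<close> for \<open>x\<^sub>0\<partial>\<^sub>0\<close>, which is a contradiction for \<open>N > 1\<close>.
  Three distinct indices are needed for the relation and the monomial \<open>M\<close>; this is where \<open>n > 2\<close> enters.

  The argument is isolated in \<open>no_quantization_if_obstructed\<close>, for any commutative algebra with a
  relation between derivations and a suitable functional.
\<close>

section \<open>Submodules and quotients\<close>

lemma CC_simps [simp]:
  "carrier CC = UNIV" "x \<otimes>\<^bsub>CC\<^esub> y = x * y" "x \<oplus>\<^bsub>CC\<^esub> y = x + y" "\<one>\<^bsub>CC\<^esub> = 1" "\<zero>\<^bsub>CC\<^esub> = 0"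
  by (simp_all add: ring_of_type_algebra_def)

lemma cring_CC: "cring CC"
  by (rule cring_from_type_algebra)

lemma (in module) span_mod_minimal:
  "submodule U R M \<Longrightarrow> S \<subseteq> U \<Longrightarrow> span_mod R M S \<subseteq> U"
  unfolding span_mod_def by blast

lemma (in module) span_mod_superset: "S \<subseteq> span_mod R M S"
  unfolding span_mod_def by blast

text \<open>
  The bound on \<open>S\<close> matters: without it, \<^const>\<open>span_mod\<close> may be an intersection over the empty family.
\<close>

lemma (in module) submodule_span_mod:
  assumes "S \<subseteq> carrier M"
  shows "submodule (span_mod R M S) R M"
proof (rule submoduleI)
  show "span_mod R M S \<subseteq> carrier M"
    by (rule span_mod_minimal[OF carrier_is_submodule assms])
  show "\<zero>\<^bsub>M\<^esub> \<in> span_mod R M S"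
    unfolding span_mod_def
    using subgroup.one_closed[OF submodule.axioms(1)] by fastforce
qed (use submoduleE(3-5) in \<open>fastforce simp: span_mod_def\<close>)+

lemma (in module) submodule_abelian_subgroup:
  assumes "submodule U R M"
  shows "abelian_subgroup U M"
  by (rule abelian_subgroupI3)
     (use assms in \<open>auto intro: additive_subgroup.intro submodule.axioms(1) M.abelian_group_axioms\<close>)

context module
begin

context
  fixes U
  assumes U: "submodule U R M"
begin

interpretation U: abelian_subgroup U M
  by (rule submodule_abelian_subgroup[OF U])

lemma carrier_quot_mod: "carrier (quot_mod M U) = (\<lambda>x. U +>\<^bsub>M\<^esub> x) ` carrier M"
  by (auto simp: quot_mod_def A_RCOSETS_def' a_r_coset_def')

lemma zero_quot_mod: "\<zero>\<^bsub>quot_mod M U\<^esub> = U"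
  by (simp add: quot_mod_def)

lemma coset_eq_iff: "x \<in> carrier M \<Longrightarrow> U +>\<^bsub>M\<^esub> x = U \<longleftrightarrow> x \<in> U"
  by (metis U.a_coset_eq U.a_rcos_self U.a_subset a_coset_join2 U.additive_subgroup_axioms
      additive_subgroup.a_subgroup)

lemma add_quot_mod:
  "x \<in> carrier M \<Longrightarrow> y \<in> carrier M \<Longrightarrow>
    (U +>\<^bsub>M\<^esub> x) \<oplus>\<^bsub>quot_mod M U\<^esub> (U +>\<^bsub>M\<^esub> y) = U +>\<^bsub>M\<^esub> (x \<oplus>\<^bsub>M\<^esub> y)"
  by (simp add: quot_mod_def U.a_rcos_sum)

lemma smult_quot_mod:
  assumes "r \<in> carrier R" "x \<in> carrier M"
  shows "r \<odot>\<^bsub>quot_mod M U\<^esub> (U +>\<^bsub>M\<^esub> x) = U +>\<^bsub>M\<^esub> (r \<odot>\<^bsub>M\<^esub> x)"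
proof -
  have "U +>\<^bsub>M\<^esub> (r \<odot>\<^bsub>M\<^esub> y) = U +>\<^bsub>M\<^esub> (r \<odot>\<^bsub>M\<^esub> x)" if y: "y \<in> U +>\<^bsub>M\<^esub> x" for y
  proof -
    obtain u where u: "u \<in> U" "y = u \<oplus>\<^bsub>M\<^esub> x"
      using y by (auto simp: a_r_coset_def')
    then have "u \<in> carrier M" using U.a_subset by auto
    then have "r \<odot>\<^bsub>M\<^esub> y = r \<odot>\<^bsub>M\<^esub> u \<oplus>\<^bsub>M\<^esub> r \<odot>\<^bsub>M\<^esub> x"
      using assms u by (simp add: smult_r_distr)
    moreover have "r \<odot>\<^bsub>M\<^esub> u \<in> U"
      using submoduleE(4)[OF U assms(1) u(1)] .
    ultimately have "r \<odot>\<^bsub>M\<^esub> y \<in> U +>\<^bsub>M\<^esub> (r \<odot>\<^bsub>M\<^esub> x)"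
      by (auto simp: a_r_coset_def')
    then show ?thesis
      using U.a_repr_independence' assms by (metis smult_closed)
  qed
  moreover have "x \<in> U +>\<^bsub>M\<^esub> x"
    using assms by (intro U.a_rcos_self)
  ultimately have "(\<Union>y\<in>U +>\<^bsub>M\<^esub> x. U +>\<^bsub>M\<^esub> (r \<odot>\<^bsub>M\<^esub> y)) = U +>\<^bsub>M\<^esub> (r \<odot>\<^bsub>M\<^esub> x)"
    by (intro UN_constant_eq) blast+
  then show ?thesis
    by (simp add: quot_mod_def)
qed

lemma quot_mod_zero_right:
  "C \<in> carrier (quot_mod M U) \<Longrightarrow> C \<oplus>\<^bsub>quot_mod M U\<^esub> \<zero>\<^bsub>quot_mod M U\<^esub> = C"
proof -
  assume "C \<in> carrier (quot_mod M U)"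
  then obtain x where "x \<in> carrier M" "C = U +>\<^bsub>M\<^esub> x"
    by (auto simp: carrier_quot_mod)
  moreover have "U +>\<^bsub>M\<^esub> \<zero>\<^bsub>M\<^esub> = U"
    using coset_eq_iff[of "\<zero>\<^bsub>M\<^esub>"] by simp
  ultimately show ?thesis
    using add_quot_mod[of x "\<zero>\<^bsub>M\<^esub>"] by (simp add: zero_quot_mod)
qed

lemma quot_mod_smult_zero: "r \<in> carrier R \<Longrightarrow> r \<odot>\<^bsub>quot_mod M U\<^esub> \<zero>\<^bsub>quot_mod M U\<^esub> = \<zero>\<^bsub>quot_mod M U\<^esub>"
proof -
  assume r: "r \<in> carrier R"
  moreover have "U +>\<^bsub>M\<^esub> \<zero>\<^bsub>M\<^esub> = U"
    using coset_eq_iff[of "\<zero>\<^bsub>M\<^esub>"] by simp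
  ultimately show ?thesis
    using smult_quot_mod[of r "\<zero>\<^bsub>M\<^esub>"] by (simp add: zero_quot_mod)
qed

end

end

context algebra
begin

lemma ideal_imp_submodule:
  assumes "ideal I M"
  shows "submodule I R M"
proof -
  interpret ideal I M by fact
  show ?thesis
  proof (rule submoduleI)
    show "a \<odot>\<^bsub>M\<^esub> x \<in> I" if "a \<in> carrier R" "x \<in> I" for a x
    proof -
      have "x \<in> carrier M" using that by simp
      then have "a \<odot>\<^bsub>M\<^esub> x = (a \<odot>\<^bsub>M\<^esub> \<one>\<^bsub>M\<^esub>) \<otimes>\<^bsub>M\<^esub> x"
        using that by (simp add: smult_assoc2)
      then show ?thesis using that by (simp add: I_l_closed)
    qed
  qed auto
qed

lemma mult_quot_mod:
  assumes "ideal I M" "x \<in> carrier M" "y \<in> carrier M"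
  shows "(I +>\<^bsub>M\<^esub> x) \<otimes>\<^bsub>quot_mod M I\<^esub> (I +>\<^bsub>M\<^esub> y) = I +>\<^bsub>M\<^esub> (x \<otimes>\<^bsub>M\<^esub> y)"
  using ideal.rcoset_mult_add[OF assms] by (simp add: quot_mod_def)

lemma algebra_quot_mod:
  assumes "ideal I M"
  shows "algebra R (quot_mod M I)"
proof -
  interpret I: ideal I M by fact
  note sub = ideal_imp_submodule[OF assms]
  note simps = carrier_quot_mod[OF sub] smult_quot_mod[OF sub] add_quot_mod[OF sub]
    mult_quot_mod[OF assms]
  have cring: "cring (M Quot I)"
    by (rule I.quotient_is_cring) (rule M_cring)
  have eqs: "carrier (quot_mod M I) = carrier (M Quot I)"
    "monoid.mult (quot_mod M I) = monoid.mult (M Quot I)" "one (quot_mod M I) = one (M Quot I)"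
    "zero (quot_mod M I) = zero (M Quot I)" "add (quot_mod M I) = add (M Quot I)"
    by (simp_all add: quot_mod_def FactRing_def)
  have "cring (quot_mod M I)"
    using cring
    unfolding cring_def ring_def abelian_group_def abelian_monoid_def abelian_group_axioms_def
      comm_monoid_def monoid_def comm_monoid_axioms_def ring_axioms_def
      comm_group_def group_def group_axioms_def Units_def partial_object.simps monoid.simps eqs
    by assumption
  then show ?thesis
    by (intro algebraI R_cring)
       (auto simp: simps smult_l_distr smult_r_distr smult_assoc1 smult_assoc2)
qed

end

section \<open>Products in a vertex algebroid\<close>

context vertex_algebroid
begin

lemma wt_closed: "a \<in> wt V i \<Longrightarrow> b \<in> wt V i \<Longrightarrow> a \<oplus> b \<in> wt V i"
  and wt_smult: "a \<in> wt V i \<Longrightarrow> c \<odot> a \<in> wt V i"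
  and wt_carrier: "a \<in> wt V i \<Longrightarrow> a \<in> carrier V"
  and zero_wt: "\<zero> \<in> wt V i"
  and wt_neg: "a \<in> wt V i \<Longrightarrow> \<ominus> a \<in> wt V i"
proof -
  have "submodule (wt V i) CC V"
  proof (cases "i \<in> {0, 1}")
    case False
    have "submodule {\<zero>} CC V"
      by (rule submoduleI) (auto simp: smult_r_null)
    with False show ?thesis
      by (simp add: wt_zero)
  qed (rule wt_submodule)
  note S = submoduleE[OF this] submodule.axioms(1)[OF this, THEN subgroup.one_closed]
  show "a \<in> wt V i \<Longrightarrow> b \<in> wt V i \<Longrightarrow> a \<oplus> b \<in> wt V i"
    "a \<in> wt V i \<Longrightarrow> c \<odot> a \<in> wt V i" "a \<in> wt V i \<Longrightarrow> a \<in> carrier V"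
    "\<zero> \<in> wt V i" "a \<in> wt V i \<Longrightarrow> \<ominus> a \<in> wt V i"
    using S by auto
qed

lemma wt0_carrier: "a \<in> wt V 0 \<Longrightarrow> a \<in> carrier V"
  and wt1_carrier: "a \<in> wt V 1 \<Longrightarrow> a \<in> carrier V"
  by (simp_all add: wt_carrier[of a 0] wt_carrier[of a 1])

lemma diff_eq_zero: "a \<in> carrier V \<Longrightarrow> b \<in> carrier V \<Longrightarrow> a \<ominus> b = \<zero> \<Longrightarrow> a = b"
  by (metis a_minus_def add.inv_solve_right' l_zero zero_closed)

lemma diff_eq_imp:
  "a \<in> carrier V \<Longrightarrow> b \<in> carrier V \<Longrightarrow> c \<in> carrier V \<Longrightarrow> a \<ominus> b = c \<Longrightarrow> a = c \<oplus> b"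
  by (metis a_minus_def add.inv_solve_right')

lemma neg_inject: "a \<in> carrier V \<Longrightarrow> b \<in> carrier V \<Longrightarrow> \<ominus> a = \<ominus> b \<Longrightarrow> a = b"
  by (metis minus_minus)

lemma smult_zero_left: "a \<in> carrier V \<Longrightarrow> 0 \<odot> a = \<zero>"
  using smult_l_null[of a] by simp

lemma smult_carrier: "a \<in> carrier V \<Longrightarrow> c \<odot> a \<in> carrier V"
  using smult_closed[of c a] by simp

lemma smult_one_left: "a \<in> carrier V \<Longrightarrow> 1 \<odot> a = a"
  using smult_one[of a] by simp

lemma finsum_single: "f i \<in> carrier V \<Longrightarrow> (\<Oplus>l\<in>{i}. f l) = f i"
  by (subst finsum_insert) auto

lemma wt_diff: "a \<in> wt V i \<Longrightarrow> b \<in> wt V i \<Longrightarrow> a \<ominus> b \<in> wt V i"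
  by (simp add: a_minus_def wt_closed wt_neg)

lemma smult_minus_one: "a \<in> carrier V \<Longrightarrow> (- 1) \<odot> a = \<ominus> a"
  using smult_l_distr[of "- 1" 1 a] smult_l_null[of a] smult_one[of a] smult_closed[of "- 1" a]
  by (simp add: minus_equality)

lemma nprod_zero_right:
  assumes "n \<ge> -1" "i \<in> {0, 1}" "j \<in> {0, 1}" "i + j - n - 1 \<le> 1" "a \<in> wt V i"
  shows "nprod V n a \<zero> = \<zero>"
proof -
  have "nprod V n a (0 \<odot> \<zero>) = 0 \<odot> nprod V n a \<zero>"
    by (rule nprod_smult_right[OF assms]) (rule zero_wt)
  moreover have "nprod V n a \<zero> \<in> carrier V"
    by (rule wt_carrier, rule nprod_wt[OF assms]) (rule zero_wt)
  ultimately show ?thesis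
    by (simp add: smult_r_null smult_zero_left)
qed

lemma nprod_zero_left:
  assumes "n \<ge> -1" "i \<in> {0, 1}" "j \<in> {0, 1}" "i + j - n - 1 \<le> 1" "b \<in> wt V j"
  shows "nprod V n \<zero> b = \<zero>"
proof -
  have "nprod V n (0 \<odot> \<zero>) b = 0 \<odot> nprod V n \<zero> b"
    by (rule nprod_smult_left[OF assms(1-4)]) (use assms in \<open>auto intro: zero_wt\<close>)
  moreover have "nprod V n \<zero> b \<in> carrier V"
    by (rule wt_carrier, rule nprod_wt[OF assms(1-4)]) (use assms in \<open>auto intro: zero_wt\<close>)
  ultimately show ?thesis
    by (simp add: smult_r_null smult_zero_left)
qed

lemmas vcarrier = wt0_carrier wt1_carrier smult_carrier

lemmas vsimps = vcarrier smult_zero_left smult_one_left smult_minus_one finsum_single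

lemma transl_zero: "transl V \<zero> = \<zero>"
  using transl_smult[OF zero_wt, of 0] transl_wt[OF zero_wt] by (simp add: vsimps)

text \<open>
  The spaces of negative weight are zero, which is how the axioms express that such products vanish.
\<close>

lemma nprod_negative_weight:
  assumes "n \<ge> -1" "i \<in> {0, 1}" "j \<in> {0, 1}" "i + j - n - 1 < 0" "a \<in> wt V i" "b \<in> wt V j"
  shows "nprod V n a b = \<zero>"
  using nprod_wt[of n i j a b] wt_zero[of "i + j - n - 1"] assms by auto

lemma mult00: "a \<in> wt V 0 \<Longrightarrow> b \<in> wt V 0 \<Longrightarrow> nprod V (-1) a b \<in> wt V 0"
  and mult01: "a \<in> wt V 0 \<Longrightarrow> v \<in> wt V 1 \<Longrightarrow> nprod V (-1) a v \<in> wt V 1"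
  and act10: "v \<in> wt V 1 \<Longrightarrow> a \<in> wt V 0 \<Longrightarrow> nprod V 0 v a \<in> wt V 0"
  and act01: "v \<in> wt V 1 \<Longrightarrow> a \<in> wt V 0 \<Longrightarrow> nprod V 0 a v \<in> wt V 0"
  and act11: "v \<in> wt V 1 \<Longrightarrow> w \<in> wt V 1 \<Longrightarrow> nprod V 0 v w \<in> wt V 1"
  and pair11: "v \<in> wt V 1 \<Longrightarrow> w \<in> wt V 1 \<Longrightarrow> nprod V 1 v w \<in> wt V 0"
  using nprod_wt[of "-1" 0 0] nprod_wt[of "-1" 0 1] nprod_wt[of 0 1 0] nprod_wt[of 0 0 1]
    nprod_wt[of 0 1 1] nprod_wt[of 1 1 1] by simp_all

lemmas wt_closure = mult00 mult01 act10 act01 act11 pair11 transl_wt wt_closed wt_smult wt_neg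
  wt_diff zero_wt

text \<open>
  The index sets that occur in the axioms once the weights are fixed.
\<close>

lemma nat_le_simps:
  "{l::nat. int l \<le> 0} = {0}" "{l::nat. int l \<le> 1} = {0, 1}" "{l::nat. 0 < l \<and> int l \<le> 1} = {1}"
  "{l::nat. l \<le> Suc 0} = {0, 1}" "{l::nat. 0 < l \<and> l \<le> Suc 0} = {1}" "{l::nat. int l \<le> - 1} = {}"
  "{l::nat. 0 < l \<and> int l \<le> 0} = {}"
  by auto

lemma skew_zero_mode:
  assumes "a \<in> wt V 0" "v \<in> wt V 1"
  shows "nprod V 0 a v = \<ominus> nprod V 0 v a"
  using skew[of 0 1 0 a v] assms act10[of v a]
  by (simp add: nat_le_simps mode_def vsimps)

lemma zero_mode_transl:
  assumes "v \<in> wt V 1" "b \<in> wt V 0"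
  shows "nprod V 0 v (transl V b) = transl V (nprod V 0 v b)"
proof -
  have "transl V (nprod V 0 v b) \<ominus> nprod V 0 v (transl V b) = \<zero>"
    using transl_comm[of 1 0 v b] assms nprod_wt[of "-1" 1 0 v b] by (simp add: mode_def vsimps)
  then show ?thesis
    by (rule diff_eq_zero[symmetric, rotated 2]) (use assms in \<open>simp_all add: wt_closure vsimps\<close>)
qed

lemma one_mode_transl:
  assumes "v \<in> wt V 1" "b \<in> wt V 0"
  shows "nprod V 1 v (transl V b) = nprod V 0 v b"
proof -
  have "nprod V 1 v b = \<zero>"
    using nprod_negative_weight[of 1 1 0 v b] assms by simp
  moreover have "nprod V 1 v (transl V b) \<in> carrier V" "nprod V 0 v b \<in> carrier V"
    using assms by (auto intro: vcarrier wt_closure)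
  moreover from calculation have "\<ominus> nprod V 1 v (transl V b) = \<ominus> nprod V 0 v b"
    using transl_comm[of 1 1 v b] assms transl_zero
    by (simp add: mode_def smult_minus_one a_minus_def)
  ultimately show ?thesis
    using neg_inject by blast
qed

lemma transl_zero_mode:
  assumes "b \<in> wt V 0" "a \<in> wt V 0"
  shows "nprod V 0 (transl V b) a = \<zero>"
  using transl_mode[of 0 0 b a] assms mult00[of b a] by (simp add: mode_def vsimps)

text \<open>
  The symbol of an element of weight 1 is the derivation \<open>v\<^sub>(\<^sub>0\<^sub>)\<close>, and this says that taking symbols is
  linear over functions.  The correction terms in the commutator with \<open>a\<^sub>(\<^sub>0\<^sub>)\<close> have negative weight, so it
  suffices to turn the product around by skew-symmetry.
\<close>

lemma zero_mode_mult:
  assumes "a \<in> wt V 0" "b \<in> wt V 0" "v \<in> wt V 1"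
  shows "nprod V 0 (nprod V (-1) b v) a = nprod V (-1) b (nprod V 0 v a)"
proof -
  have "nprod V 0 a (nprod V (-1) b v) \<ominus> nprod V (-1) b (nprod V 0 a v) = \<zero>"
    using commutator[of 0 0 1 a b v "-1" 0] assms by (simp add: mode_def nat_le_simps)
  then have eq: "nprod V 0 a (nprod V (-1) b v) = nprod V (-1) b (nprod V 0 a v)"
    by (rule diff_eq_zero[rotated 2]) (use assms in \<open>simp_all add: wt_closure vsimps\<close>)
  have "nprod V (-1) b ((- 1) \<odot> nprod V 0 v a) = (- 1) \<odot> nprod V (-1) b (nprod V 0 v a)"
    using nprod_smult_right[of "-1" 0 0 b "nprod V 0 v a" "- 1"] assms by (simp add: wt_closure)
  then have "nprod V (-1) b (nprod V 0 a v) = \<ominus> nprod V (-1) b (nprod V 0 v a)"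
    using assms by (simp add: skew_zero_mode vsimps wt_closure)
  with eq have "\<ominus> nprod V 0 (nprod V (-1) b v) a = \<ominus> nprod V (-1) b (nprod V 0 v a)"
    using assms by (simp add: skew_zero_mode wt_closure)
  then show ?thesis
    by (rule neg_inject[rotated 2]) (use assms in \<open>simp_all add: wt_closure vsimps\<close>)
qed

text \<open>
  The quantum correction.  In a Courant algebroid the pairing \<open>v\<^sub>(\<^sub>1\<^sub>)\<close> is linear over functions; here
  the commutator of \<open>v\<^sub>(\<^sub>1\<^sub>)\<close> and \<open>b\<^sub>(\<^sub>-\<^sub>1\<^sub>)\<close> contributes the action of \<open>w\<close> on the derivative of \<open>b\<close>.
\<close>

lemma one_mode_mult:
  assumes "v \<in> wt V 1" "b \<in> wt V 0" "w \<in> wt V 1"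
  shows "nprod V 1 v (nprod V (-1) b w)
       = nprod V (-1) b (nprod V 1 v w) \<ominus> nprod V 0 w (nprod V 0 v b)"
proof -
  have "nprod V 1 v (nprod V (-1) b w) \<ominus> nprod V (-1) b (nprod V 1 v w) = nprod V 0 (nprod V 0 v b) w"
    using commutator[of 1 0 1 v b w "-1" 1] assms by (simp add: mode_def nat_le_simps wt_closure vsimps)
  also have "\<dots> = \<ominus> nprod V 0 w (nprod V 0 v b)"
    using assms by (simp add: skew_zero_mode wt_closure)
  finally show ?thesis
    unfolding a_minus_def
    by (subst a_comm, goal_cases)
       (use assms in \<open>simp_all add: wt_closure vsimps diff_eq_imp[unfolded a_minus_def]\<close>)
qed

lemma zero_mode_derivation:
  assumes "v \<in> wt V 1" "b \<in> wt V 0" "w \<in> wt V 1"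
  shows "nprod V 0 v (nprod V (-1) b w)
       = nprod V (-1) (nprod V 0 v b) w \<oplus> nprod V (-1) b (nprod V 0 v w)"
proof -
  have "nprod V 0 v (nprod V (-1) b w) \<ominus> nprod V (-1) b (nprod V 0 v w) = nprod V (-1) (nprod V 0 v b) w"
    using commutator[of 1 0 1 v b w "-1" 0] assms by (simp add: mode_def nat_le_simps wt_closure vsimps)
  then show ?thesis
    by (rule diff_eq_imp[rotated 3]) (use assms in \<open>simp_all add: wt_closure vsimps\<close>)
qed

text \<open>
  In general \<open>a(bv)\<close> and \<open>(ab)v\<close> differ by terms containing the derivatives of \<open>a\<close> and \<open>b\<close> along \<open>v\<close>,
  and these vanish for \<open>v = T(c)\<close>.
\<close>

lemma mult_assoc_exact:
  assumes "a \<in> wt V 0" "b \<in> wt V 0" "c \<in> wt V 0"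
  shows "nprod V (-1) a (nprod V (-1) b (transl V c)) = nprod V (-1) (nprod V (-1) a b) (transl V c)"
proof -
  have z: "nprod V 0 x (transl V c) = \<zero>" if "x \<in> wt V 0" for x
    using that assms by (simp add: skew_zero_mode transl_zero_mode wt_closure)
  have z': "nprod V (-1) (transl V x) \<zero> = \<zero>" if "x \<in> wt V 0" for x
    using that nprod_zero_right[of "-1" 1 0 "transl V x"] by (simp add: wt_closure)
  show ?thesis
    using normal_ordered[of 0 0 1 a b "transl V c" "-1"] assms
    by (simp add: mode_def nat_le_simps wt_closure vsimps z z')
qed

section \<open>The exact part of a vertex algebroid\<close>

lemma exact_wt: "a \<in> wt V 0 \<Longrightarrow> b \<in> wt V 0 \<Longrightarrow> nprod V (-1) a (transl V b) \<in> wt V 1"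
  by (simp add: wt_closure)

lemma filt0_submodule: "submodule (filt0 V) CC V"
  unfolding filt0_def by (rule submodule_span_mod) (auto intro: vcarrier exact_wt)

lemma filt0_generator: "a \<in> wt V 0 \<Longrightarrow> b \<in> wt V 0 \<Longrightarrow> nprod V (-1) a (transl V b) \<in> filt0 V"
  unfolding filt0_def by (rule subsetD[OF span_mod_superset]) auto

lemma filt0_induct [consumes 1, case_names zero add smult gen]:
  assumes "\<omega> \<in> filt0 V"
    and "P \<zero>"
    and "\<And>\<omega> \<eta>. \<omega> \<in> wt V 1 \<Longrightarrow> \<eta> \<in> wt V 1 \<Longrightarrow> P \<omega> \<Longrightarrow> P \<eta> \<Longrightarrow> P (\<omega> \<oplus> \<eta>)"
    and "\<And>c \<omega>. \<omega> \<in> wt V 1 \<Longrightarrow> P \<omega> \<Longrightarrow> P (c \<odot> \<omega>)"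
    and "\<And>a b. a \<in> wt V 0 \<Longrightarrow> b \<in> wt V 0 \<Longrightarrow> P (nprod V (-1) a (transl V b))"
  shows "P \<omega>"
proof -
  have "submodule {\<omega> \<in> wt V 1. P \<omega>} CC V"
  proof (rule submoduleI)
    show "\<ominus> x \<in> {\<omega> \<in> wt V 1. P \<omega>}" if "x \<in> {\<omega> \<in> wt V 1. P \<omega>}" for x
      using that assms(4)[of x "- 1"] by (simp add: vsimps wt_neg)
  qed (use assms(2-4) in \<open>auto simp: vcarrier wt_closure\<close>)
  then have "filt0 V \<subseteq> {\<omega> \<in> wt V 1. P \<omega>}"
    unfolding filt0_def by (rule span_mod_minimal) (use assms(5) in \<open>auto intro: exact_wt\<close>)
  then show ?thesis using assms(1) by blast
qed

lemma filt0_wt: "\<omega> \<in> filt0 V \<Longrightarrow> \<omega> \<in> wt V 1"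
  by (induction rule: filt0_induct) (auto intro: exact_wt simp: wt_closure)

text \<open>
  The exact part consists of differential forms, so its elements have zero symbol.
\<close>

lemma filt0_zero_mode:
  assumes "\<omega> \<in> filt0 V" "a \<in> wt V 0"
  shows "nprod V 0 \<omega> a = \<zero>"
  using assms(1)
proof (induction rule: filt0_induct)
  case zero
  then show ?case using nprod_zero_left[of 0 1 0 a] assms(2) by simp
next
  case (add \<omega> \<eta>)
  then show ?case using nprod_add_left[of 0 1 0 \<omega> \<eta> a] assms(2) by simp
next
  case (smult c \<omega>)
  then show ?case using nprod_smult_left[of 0 1 0 \<omega> a c] assms(2) by simp
next
  case (gen b c)
  then show ?case
    using nprod_zero_right[of "-1" 0 0 b] assms(2)
    by (simp add: zero_mode_mult transl_zero_mode wt_closure)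
qed

lemma filt0_closed: "\<omega> \<in> filt0 V \<Longrightarrow> \<eta> \<in> filt0 V \<Longrightarrow> \<omega> \<oplus> \<eta> \<in> filt0 V"
  and filt0_smult: "\<omega> \<in> filt0 V \<Longrightarrow> c \<odot> \<omega> \<in> filt0 V"
  and filt0_zero: "\<zero> \<in> filt0 V"
  using submoduleE[OF filt0_submodule] submodule.axioms(1)[OF filt0_submodule, THEN subgroup.one_closed]
  by auto

lemma filt0_action:
  assumes "\<omega> \<in> filt0 V" "v \<in> wt V 1"
  shows "nprod V 0 v \<omega> \<in> filt0 V"
  using assms(1)
proof (induction rule: filt0_induct)
  case zero
  then show ?case using nprod_zero_right[of 0 1 1 v] assms(2) by (simp add: filt0_zero)
next
  case (add \<omega> \<eta>)
  then show ?case using nprod_add_right[of 0 1 1 v \<omega> \<eta>] assms(2) by (simp add: filt0_closed)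
next
  case (smult c \<omega>)
  then show ?case using nprod_smult_right[of 0 1 1 v \<omega> c] assms(2) by (simp add: filt0_smult)
next
  case (gen a b)
  then show ?case
    using assms(2)
    by (simp add: zero_mode_derivation zero_mode_transl wt_closure filt0_generator filt0_closed)
qed

text \<open>
  The products of the associated graded space involve an arbitrary representative of the zero coset;
  its product with another exact element must therefore be known to vanish.
\<close>

lemma filt0_filt0:
  assumes "\<omega> \<in> filt0 V" "\<eta> \<in> filt0 V"
  shows "nprod V 0 \<eta> \<omega> = \<zero>"
  using assms(1)
proof (induction rule: filt0_induct)
  case zero
  then show ?case using nprod_zero_right[of 0 1 1 \<eta>] assms(2) by (simp add: filt0_wt)
next
  case (add \<omega> \<xi>)
  then show ?case using nprod_add_right[of 0 1 1 \<eta> \<omega> \<xi>] assms(2) by (simp add: filt0_wt)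
next
  case (smult c \<omega>)
  then show ?case using nprod_smult_right[of 0 1 1 \<eta> \<omega> c] assms(2) by (simp add: filt0_wt)
next
  case (gen a b)
  have "nprod V 0 \<eta> a = \<zero>" "nprod V 0 \<eta> b = \<zero>"
    using gen assms(2) by (auto intro: filt0_zero_mode)
  then show ?case
    using gen assms(2) nprod_zero_right[of "-1" 0 1 a] nprod_zero_left[of "-1" 0 1 "transl V b"]
    by (simp add: zero_mode_derivation zero_mode_transl wt_closure filt0_wt transl_zero)
qed

lemma filt0_mult:
  assumes "\<omega> \<in> filt0 V" "a \<in> wt V 0"
  shows "nprod V (-1) a \<omega> \<in> filt0 V"
  using assms(1)
proof (induction rule: filt0_induct)
  case zero
  then show ?case using nprod_zero_right[of "-1" 0 1 a] assms(2) by (simp add: filt0_zero)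
next
  case (add \<omega> \<xi>)
  then show ?case using nprod_add_right[of "-1" 0 1 a \<omega> \<xi>] assms(2) by (simp add: filt0_closed)
next
  case (smult c \<omega>)
  then show ?case using nprod_smult_right[of "-1" 0 1 a \<omega> c] assms(2) by (simp add: filt0_smult)
next
  case (gen b c)
  then show ?case
    using assms(2) by (simp add: mult_assoc_exact wt_closure filt0_generator)
qed

end

section \<open>Kaehler differentials\<close>

lemma free_mod_simps:
  "f \<oplus>\<^bsub>free_mod A\<^esub> g = (\<lambda>x. f x \<oplus>\<^bsub>A\<^esub> g x)" "a \<odot>\<^bsub>free_mod A\<^esub> f = (\<lambda>x. a \<otimes>\<^bsub>A\<^esub> f x)"
  "\<zero>\<^bsub>free_mod A\<^esub> = (\<lambda>_. \<zero>\<^bsub>A\<^esub>)"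
  by (simp_all add: free_mod_def)

lemma free_mod_carrier_iff:
  "f \<in> carrier (free_mod A) \<longleftrightarrow>
    (\<forall>x. f x \<in> carrier A) \<and> (\<forall>x. x \<notin> carrier A \<longrightarrow> f x = \<zero>\<^bsub>A\<^esub>) \<and> finite {x. f x \<noteq> \<zero>\<^bsub>A\<^esub>}"
  by (auto simp: free_mod_def)

lemma module_free_mod:
  fixes A :: "(complex, 'b) module"
  assumes "cring A"
  shows "module A (free_mod A)"
proof -
  interpret A: cring A by fact
  have add: "f \<oplus>\<^bsub>free_mod A\<^esub> g \<in> carrier (free_mod A)"
    if "f \<in> carrier (free_mod A)" "g \<in> carrier (free_mod A)" for f g
  proof -
    have "{x. f x \<oplus>\<^bsub>A\<^esub> g x \<noteq> \<zero>\<^bsub>A\<^esub>} \<subseteq> {x. f x \<noteq> \<zero>\<^bsub>A\<^esub>} \<union> {x. g x \<noteq> \<zero>\<^bsub>A\<^esub>}"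
      using that by (auto simp: free_mod_carrier_iff)
    with that show ?thesis
      by (auto simp: free_mod_carrier_iff free_mod_simps intro: finite_subset)
  qed
  have smult: "a \<odot>\<^bsub>free_mod A\<^esub> f \<in> carrier (free_mod A)"
    if "a \<in> carrier A" "f \<in> carrier (free_mod A)" for a f
  proof -
    have "{x. a \<otimes>\<^bsub>A\<^esub> f x \<noteq> \<zero>\<^bsub>A\<^esub>} \<subseteq> {x. f x \<noteq> \<zero>\<^bsub>A\<^esub>}"
      using that by (auto simp: free_mod_carrier_iff)
    with that show ?thesis
      by (auto simp: free_mod_carrier_iff free_mod_simps intro: finite_subset)
  qed
  have neg: "(\<lambda>x. \<ominus>\<^bsub>A\<^esub> f x) \<in> carrier (free_mod A)" if "f \<in> carrier (free_mod A)" for f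
  proof -
    have "{x. \<ominus>\<^bsub>A\<^esub> f x \<noteq> \<zero>\<^bsub>A\<^esub>} \<subseteq> {x. f x \<noteq> \<zero>\<^bsub>A\<^esub>}"
      using that by (auto simp: free_mod_carrier_iff)
    with that show ?thesis
      by (auto simp: free_mod_carrier_iff intro: finite_subset)
  qed
  show ?thesis
  proof (rule moduleI)
    show "abelian_group (free_mod A)"
    proof (rule abelian_groupI)
      show "\<exists>y\<in>carrier (free_mod A). y \<oplus>\<^bsub>free_mod A\<^esub> x = \<zero>\<^bsub>free_mod A\<^esub>"
        if "x \<in> carrier (free_mod A)" for x
        using that by (intro bexI[OF _ neg[OF that]]) (auto simp: free_mod_carrier_iff free_mod_simps A.l_neg)
    qed (use add in \<open>auto simp: free_mod_carrier_iff free_mod_simps A.a_ac\<close>)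
  qed (use smult assms in \<open>auto simp: free_mod_carrier_iff free_mod_simps A.l_distr A.r_distr A.m_assoc\<close>)
qed

text \<open>
  The locale \<^locale>\<open>algebra\<close> over the complex numbers, for records without further fields, since
  \<^const>\<open>free_mod\<close> and \<^const>\<open>kaehler\<close> are defined for these only.
\<close>

locale complex_algebra = algebra CC A for A :: "(complex, 'a) module" (structure)
begin

sublocale F: module A "free_mod A"
  by (rule module_free_mod[OF M_cring])

lemma smult_in: "x \<in> carrier A \<Longrightarrow> c \<odot> x \<in> carrier A"
  using smult_closed[of c x] by simp

lemma free_gen_carrier: "x \<in> carrier A \<Longrightarrow> free_gen A x \<in> carrier (free_mod A)"
  by (auto simp: free_mod_carrier_iff free_gen_def)

lemma submodule_kaehler_rels: "submodule (span_mod A (free_mod A) (kaehler_rels A)) A (free_mod A)"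
proof (rule F.submodule_span_mod)
  show "kaehler_rels A \<subseteq> carrier (free_mod A)"
    by (auto simp: kaehler_rels_def Let_def free_gen_carrier smult_in
        intro!: F.minus_closed F.add.m_closed F.smult_closed)
qed

lemmas kaehler_add = F.add_quot_mod[OF submodule_kaehler_rels, folded kaehler_def]
  and kaehler_smult = F.smult_quot_mod[OF submodule_kaehler_rels, folded kaehler_def]
  and kaehler_zero = F.zero_quot_mod[OF submodule_kaehler_rels, folded kaehler_def]
  and kaehler_zero_right = F.quot_mod_zero_right[OF submodule_kaehler_rels, folded kaehler_def]
  and kaehler_smult_zero = F.quot_mod_smult_zero[OF submodule_kaehler_rels, folded kaehler_def]
  and kaehler_carrier = F.carrier_quot_mod[OF submodule_kaehler_rels, folded kaehler_def]

lemma kaehler_smult_kd_carrier: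
  "a \<in> carrier A \<Longrightarrow> x \<in> carrier A \<Longrightarrow> a \<odot>\<^bsub>kaehler A\<^esub> kd A x \<in> carrier (kaehler A)"
  by (auto simp: kd_def kaehler_smult kaehler_carrier free_gen_carrier)

text \<open>
  A differential is a coset of a finitely supported function, so an induction on the support writes it
  as a finite sum of terms \<open>a db\<close>.
\<close>

lemma kaehler_induct [consumes 1, case_names zero add gen]:
  assumes "\<eta> \<in> carrier (kaehler A)"
    and "P \<zero>\<^bsub>kaehler A\<^esub>"
    and "\<And>\<omega> \<eta>. P \<omega> \<Longrightarrow> P \<eta> \<Longrightarrow> P (\<omega> \<oplus>\<^bsub>kaehler A\<^esub> \<eta>)"
    and "\<And>a b. a \<in> carrier A \<Longrightarrow> b \<in> carrier A \<Longrightarrow> P (a \<odot>\<^bsub>kaehler A\<^esub> kd A b)"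
  shows "P \<eta>"
proof -
  let ?K = "span_mod A (free_mod A) (kaehler_rels A)"
  have *: "P (?K +>\<^bsub>free_mod A\<^esub> g)"
    if "finite S" "g \<in> carrier (free_mod A)" "{x. g x \<noteq> \<zero>} \<subseteq> S" for S g
    using that
  proof (induction S arbitrary: g rule: finite_induct)
    case empty
    then have "g = \<zero>\<^bsub>free_mod A\<^esub>" by (auto simp: free_mod_simps)
    moreover have "?K +>\<^bsub>free_mod A\<^esub> \<zero>\<^bsub>free_mod A\<^esub> = \<zero>\<^bsub>kaehler A\<^esub>"
      using F.coset_eq_iff[OF submodule_kaehler_rels, of "\<zero>\<^bsub>free_mod A\<^esub>"]
        subgroup.one_closed[OF submodule.axioms(1)[OF submodule_kaehler_rels]]
      by (simp add: kaehler_zero)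
    ultimately show ?case using assms(2) by simp
  next
    case (insert x S)
    show ?case
    proof (cases "x \<in> carrier A")
      case False
      then have "g x = \<zero>" using insert.prems(1) by (simp add: free_mod_carrier_iff)
      then have "{x. g x \<noteq> \<zero>} \<subseteq> S" using insert.prems(2) by auto
      then show ?thesis using insert.IH insert.prems(1) by blast
    next
      case True
      let ?h = "g(x := \<zero>)"
      have gx: "g x \<in> carrier A" using insert.prems(1) by (simp add: free_mod_carrier_iff)
      have h: "?h \<in> carrier (free_mod A)"
        using insert.prems(1) by (auto simp: free_mod_carrier_iff elim: finite_subset[rotated])
      have "P (?K +>\<^bsub>free_mod A\<^esub> ?h)"
        by (rule insert.IH[OF h]) (use insert.prems(2) in auto)
      moreover have "P (?K +>\<^bsub>free_mod A\<^esub> (g x \<odot>\<^bsub>free_mod A\<^esub> free_gen A x))"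
        using assms(4)[OF gx True] gx True by (simp add: kd_def kaehler_smult free_gen_carrier)
      ultimately have "P ((?K +>\<^bsub>free_mod A\<^esub> ?h) \<oplus>\<^bsub>kaehler A\<^esub>
          (?K +>\<^bsub>free_mod A\<^esub> (g x \<odot>\<^bsub>free_mod A\<^esub> free_gen A x)))"
        by (rule assms(3))
      also have "(?K +>\<^bsub>free_mod A\<^esub> ?h) \<oplus>\<^bsub>kaehler A\<^esub>
          (?K +>\<^bsub>free_mod A\<^esub> (g x \<odot>\<^bsub>free_mod A\<^esub> free_gen A x))
          = ?K +>\<^bsub>free_mod A\<^esub> (?h \<oplus>\<^bsub>free_mod A\<^esub> (g x \<odot>\<^bsub>free_mod A\<^esub> free_gen A x))"
        by (rule kaehler_add[OF h]) (use gx True free_gen_carrier F.smult_closed in blast)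
      also have "?h \<oplus>\<^bsub>free_mod A\<^esub> (g x \<odot>\<^bsub>free_mod A\<^esub> free_gen A x) = g"
        using insert.prems(1) gx
        by (auto simp: free_mod_simps free_gen_def free_mod_carrier_iff fun_eq_iff)
      finally show ?thesis .
    qed
  qed
  obtain g where "g \<in> carrier (free_mod A)" "\<eta> = ?K +>\<^bsub>free_mod A\<^esub> g"
    using assms(1) by (auto simp: kaehler_carrier)
  then show ?thesis
    using *[of "{x. g x \<noteq> \<zero>}" g] by (simp add: free_mod_carrier_iff)
qed

end

section \<open>Symbols\<close>

context vertex_algebroid
begin

lemmas filt0_quot_add = add_quot_mod[OF filt0_submodule]

lemma filt0_coset_eq: "\<omega> \<in> filt0 V \<Longrightarrow> filt0 V +>\<^bsub>V\<^esub> \<omega> = filt0 V"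
  using coset_eq_iff[OF filt0_submodule, of \<omega>] by (simp add: filt0_wt vsimps)

lemma some_filt0: "(SOME y. y \<in> filt0 V) \<in> filt0 V"
  using filt0_zero by (rule someI)

lemma some_coset:
  assumes "v \<in> wt V 1"
  obtains u where "u \<in> filt0 V" "(SOME x. x \<in> filt0 V +>\<^bsub>V\<^esub> v) = u \<oplus> v"
proof -
  have "\<zero> \<oplus> v \<in> filt0 V +>\<^bsub>V\<^esub> v"
    using filt0_zero by (auto simp: a_r_coset_def')
  then have "(SOME x. x \<in> filt0 V +>\<^bsub>V\<^esub> v) \<in> filt0 V +>\<^bsub>V\<^esub> v" by (rule someI)
  then show ?thesis using that by (auto simp: a_r_coset_def')
qed

text \<open>
  The products of \<^const>\<open>gr\<close> contain representatives picked by choice, even of the zero coset, so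
  that evaluating them requires the vanishing and invariance properties of the exact part.
\<close>

lemma gr_mult_exact:
  assumes "a \<in> wt V 0" "\<omega> \<in> filt0 V"
  shows "nprod (gr V) (-1) (a, \<zero>, filt0 V) (\<zero>, \<omega>, filt0 V) = (\<zero>, nprod V (-1) a \<omega>, filt0 V)"
proof -
  define y where "y = (SOME y. y \<in> filt0 V)"
  have y: "y \<in> filt0 V" unfolding y_def by (rule some_filt0)
  have "nprod V (-1) a \<zero> = \<zero>" "nprod V (-1) \<zero> \<zero> = \<zero>" "nprod V (-1) y \<zero> = \<zero>"
    using nprod_zero_right[of "-1" 0 0 a] nprod_zero_right[of "-1" 0 0 \<zero>]
      nprod_zero_right[of "-1" 1 0 y] assms y zero_wt by (simp_all add: filt0_wt)
  then show ?thesis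
    using filt0_mult[OF y assms(1)] filt0_mult[OF assms(2,1)]
    by (simp add: gr_def Let_def flip: y_def)
       (simp add: filt0_wt vsimps filt0_coset_eq)
qed

text \<open>
  The difference of the two products is \<open>T\<close> of \<open>b\<^sub>(\<^sub>0\<^sub>)\<omega>\<close>, which is zero.
\<close>

lemma filt0_mult_right:
  assumes "\<omega> \<in> filt0 V" "b \<in> wt V 0"
  shows "nprod V (-1) \<omega> b = nprod V (-1) b \<omega>"
proof -
  have "nprod V 0 b \<omega> = \<zero>"
    using assms by (simp add: skew_zero_mode filt0_wt filt0_zero_mode)
  then show ?thesis
    using skew[of 1 0 "-1" \<omega> b] assms mult01[of b \<omega>]
    by (simp add: mode_def nat_le_simps filt0_wt vsimps transl_zero)
qed

lemma gr_mult_weight0: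
  assumes "a \<in> wt V 0" "b \<in> wt V 0"
  shows "nprod (gr V) (-1) (a, \<zero>, filt0 V) (b, \<zero>, filt0 V) = (nprod V (-1) a b, \<zero>, filt0 V)"
proof -
  define y where "y = (SOME y. y \<in> filt0 V)"
  have y: "y \<in> filt0 V" unfolding y_def by (rule some_filt0)
  have z: "nprod V (-1) a \<zero> = \<zero>" "nprod V (-1) \<zero> b = \<zero>"
    using nprod_zero_right[of "-1" 0 0 a] nprod_zero_left[of "-1" 0 0 b] assms by (simp_all)
  have "nprod V (-1) y b \<in> filt0 V"
    using assms y by (simp add: filt0_mult_right filt0_mult)
  then show ?thesis
    using filt0_mult[OF y assms(1)] z
    by (simp add: gr_def Let_def flip: y_def)
       (simp add: filt0_wt vsimps filt0_coset_eq filt0_closed)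
qed

lemma gr_action:
  assumes "\<omega> \<in> filt0 V" "v \<in> wt V 1" "a \<in> wt V 0"
  shows "nprod (gr V) 0 (\<zero>, \<omega>, filt0 V +>\<^bsub>V\<^esub> v) (a, \<zero>, filt0 V) = (nprod V 0 v a, \<zero>, filt0 V)"
proof -
  define x where "x = (SOME x. x \<in> filt0 V +>\<^bsub>V\<^esub> v)"
  define y where "y = (SOME y. y \<in> filt0 V)"
  have y: "y \<in> filt0 V" unfolding y_def by (rule some_filt0)
  obtain u where u: "u \<in> filt0 V" and x: "x = u \<oplus> v"
    unfolding x_def by (rule some_coset[OF assms(2)])
  have xw: "x \<in> wt V 1" using u assms x by (simp add: filt0_wt wt_closure)
  have "nprod V 0 \<zero> y = \<zero>" "nprod V 0 x \<zero> = \<zero>"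
    using nprod_zero_left[of 0 0 1 y] nprod_zero_right[of 0 1 1 x] y xw by (simp_all add: filt0_wt)
  moreover have "nprod V 0 x a = nprod V 0 v a"
    using nprod_add_left[of 0 1 0 u v a] u assms filt0_zero_mode[of u a]
    by (simp add: x filt0_wt wt_closure vsimps)
  moreover have "nprod V 0 \<omega> y = \<zero>" "nprod V 0 x y \<in> filt0 V"
    using y assms xw by (auto intro: filt0_filt0 filt0_action)
  ultimately show ?thesis
    using assms
    by (simp add: gr_def Let_def flip: x_def y_def)
       (simp add: vsimps wt_closure filt0_coset_eq)
qed

lemma gr_simps:
  "wt (gr V) 0 = wt V 0 \<times> {\<zero>} \<times> {filt0 V}"
  "wt (gr V) 1 = {\<zero>} \<times> filt0 V \<times> ((\<lambda>x. filt0 V +>\<^bsub>V\<^esub> x) ` wt V 1)"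
  "carrier (gr V) = wt V 0 \<times> filt0 V \<times> ((\<lambda>x. filt0 V +>\<^bsub>V\<^esub> x) ` wt V 1)"
  "transl (gr V) (a, \<omega>, C) = (\<zero>, transl V a, filt0 V)"
  by (simp_all add: gr_def Let_def)

lemma filt0_in_cosets: "filt0 V \<in> (\<lambda>x. filt0 V +>\<^bsub>V\<^esub> x) ` wt V 1"
  using filt0_coset_eq[OF filt0_zero] zero_wt by (metis image_eqI)

lemma filt0_add_filt0: "filt0 V \<oplus>\<^bsub>quot_mod V (filt0 V)\<^esub> filt0 V = filt0 V"
  using filt0_quot_add[of \<zero> \<zero>] filt0_coset_eq[OF filt0_zero] by simp

lemma filt0_smult_filt0: "c \<odot>\<^bsub>quot_mod V (filt0 V)\<^esub> filt0 V = filt0 V"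
  using smult_quot_mod[OF filt0_submodule, of c \<zero>] filt0_coset_eq[OF filt0_zero] smult_r_null[of c]
  by simp

lemma gr_add_exact:
  "(\<zero>, \<omega>, filt0 V) \<oplus>\<^bsub>gr V\<^esub> (\<zero>, \<eta>, filt0 V) = (\<zero>, \<omega> \<oplus> \<eta>, filt0 V)"
  "a \<in> wt V 0 \<Longrightarrow> b \<in> wt V 0 \<Longrightarrow>
    (a, \<zero>, filt0 V) \<oplus>\<^bsub>gr V\<^esub> (b, \<zero>, filt0 V) = (a \<oplus> b, \<zero>, filt0 V)"
  "a \<in> wt V 0 \<Longrightarrow> c \<odot>\<^bsub>gr V\<^esub> (a, \<zero>, filt0 V) = (c \<odot> a, \<zero>, filt0 V)"
  using smult_r_null[of c]
  by (simp_all add: gr_def Let_def filt0_add_filt0 filt0_smult_filt0)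

end

section \<open>Lifting derivations to a quantization\<close>

locale quantization = vertex_algebroid V + A: complex_algebra A
  for V :: "'v algebroid" and A :: "(complex, 'a) module" +
  fixes \<phi>
  assumes iso: "algebroid_iso (gr V) (courant_of A) \<phi>"
begin

text \<open>
  The isomorphism of associated graded algebroids identifies the weight 0 part of \<open>V\<close> with \<open>A\<close>.
\<close>

definition ring_elem :: "'v \<Rightarrow> 'a" where
  "ring_elem a = fst (\<phi> (a, \<zero>\<^bsub>V\<^esub>, filt0 V))"

lemma courant_simps:
  "wt (courant_of A) 0 = carrier A \<times> {\<lambda>_. \<zero>\<^bsub>A\<^esub>} \<times> {\<zero>\<^bsub>kaehler A\<^esub>}"
  "wt (courant_of A) 1 = {\<zero>\<^bsub>A\<^esub>} \<times> derivations A \<times> carrier (kaehler A)"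
  "transl (courant_of A) (a, \<tau>, \<omega>) = (\<zero>\<^bsub>A\<^esub>, \<lambda>_. \<zero>\<^bsub>A\<^esub>, kd A a)"
  "c \<odot>\<^bsub>courant_of A\<^esub> (a, \<tau>, \<omega>)
     = (c \<odot>\<^bsub>A\<^esub> a, \<lambda>x. c \<odot>\<^bsub>A\<^esub> \<tau> x, (c \<odot>\<^bsub>A\<^esub> \<one>\<^bsub>A\<^esub>) \<odot>\<^bsub>kaehler A\<^esub> \<omega>)"
  "(a, \<tau>, \<omega>) \<oplus>\<^bsub>courant_of A\<^esub> (b, \<xi>, \<eta>)
     = (a \<oplus>\<^bsub>A\<^esub> b, \<lambda>x. \<tau> x \<oplus>\<^bsub>A\<^esub> \<xi> x, \<omega> \<oplus>\<^bsub>kaehler A\<^esub> \<eta>)"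
  by (simp_all add: courant_of_def Let_def)

lemma iso_bij: "bij_betw \<phi> (carrier (gr V)) (carrier (courant_of A))"
  and iso_add: "x \<in> carrier (gr V) \<Longrightarrow> y \<in> carrier (gr V) \<Longrightarrow>
      \<phi> (x \<oplus>\<^bsub>gr V\<^esub> y) = \<phi> x \<oplus>\<^bsub>courant_of A\<^esub> \<phi> y"
  and iso_smult: "x \<in> carrier (gr V) \<Longrightarrow> \<phi> (c \<odot>\<^bsub>gr V\<^esub> x) = c \<odot>\<^bsub>courant_of A\<^esub> \<phi> x"
  and iso_wt0: "\<phi> ` wt (gr V) 0 = wt (courant_of A) 0"
  and iso_wt1: "\<phi> ` wt (gr V) 1 = wt (courant_of A) 1"
  and iso_transl: "x \<in> wt (gr V) 0 \<Longrightarrow> \<phi> (transl (gr V) x) = transl (courant_of A) (\<phi> x)"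
  and iso_nprod: "n \<ge> -1 \<Longrightarrow> i \<in> {0, 1} \<Longrightarrow> j \<in> {0, 1} \<Longrightarrow> i + j - n - 1 \<le> 1 \<Longrightarrow>
      x \<in> wt (gr V) i \<Longrightarrow> y \<in> wt (gr V) j \<Longrightarrow>
      \<phi> (nprod (gr V) n x y) = nprod (courant_of A) n (\<phi> x) (\<phi> y)"
  using iso unfolding algebroid_iso_def by blast+

lemma weight0_in: "a \<in> wt V 0 \<Longrightarrow> (a, \<zero>\<^bsub>V\<^esub>, filt0 V) \<in> wt (gr V) 0"
  by (simp add: gr_simps)

lemma weight1_in: "\<omega> \<in> filt0 V \<Longrightarrow> v \<in> wt V 1 \<Longrightarrow> (\<zero>\<^bsub>V\<^esub>, \<omega>, filt0 V +>\<^bsub>V\<^esub> v) \<in> wt (gr V) 1"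
  by (simp add: gr_simps)

lemma exact_in: "\<omega> \<in> filt0 V \<Longrightarrow> (\<zero>\<^bsub>V\<^esub>, \<omega>, filt0 V) \<in> wt (gr V) 1"
  using filt0_in_cosets by (simp add: gr_simps)

lemma gr_wt_carrier: "i \<in> {0, 1} \<Longrightarrow> x \<in> wt (gr V) i \<Longrightarrow> x \<in> carrier (gr V)"
  using filt0_in_cosets filt0_zero zero_wt by (auto simp: gr_simps)

lemma iso_weight0:
  assumes "a \<in> wt V 0"
  shows "\<phi> (a, \<zero>\<^bsub>V\<^esub>, filt0 V) = (ring_elem a, \<lambda>_. \<zero>\<^bsub>A\<^esub>, \<zero>\<^bsub>kaehler A\<^esub>)"
    and "ring_elem a \<in> carrier A"
proof -
  have "\<phi> (a, \<zero>\<^bsub>V\<^esub>, filt0 V) \<in> wt (courant_of A) 0"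
    using weight0_in[OF assms] iso_wt0 by blast
  then show "\<phi> (a, \<zero>\<^bsub>V\<^esub>, filt0 V) = (ring_elem a, \<lambda>_. \<zero>\<^bsub>A\<^esub>, \<zero>\<^bsub>kaehler A\<^esub>)" "ring_elem a \<in> carrier A"
    by (auto simp: ring_elem_def courant_simps)
qed

lemma ring_elem_inject:
  assumes "ring_elem a = ring_elem b" "a \<in> wt V 0" "b \<in> wt V 0"
  shows "a = b"
proof -
  have "\<phi> (a, \<zero>\<^bsub>V\<^esub>, filt0 V) = \<phi> (b, \<zero>\<^bsub>V\<^esub>, filt0 V)"
    using assms by (simp add: iso_weight0)
  then show ?thesis
    using inj_onD[OF bij_betw_imp_inj_on[OF iso_bij]] assms gr_wt_carrier[of 0] weight0_in by blast
qed

lemma ring_elem_surj: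
  assumes "b \<in> carrier A"
  obtains a where "a \<in> wt V 0" "ring_elem a = b"
proof -
  have "(b, \<lambda>_. \<zero>\<^bsub>A\<^esub>, \<zero>\<^bsub>kaehler A\<^esub>) \<in> \<phi> ` wt (gr V) 0"
    using assms by (simp add: iso_wt0 courant_simps)
  then show ?thesis
    using that iso_weight0 by (auto simp: gr_simps)
qed

lemma ring_elem_add:
  assumes "a \<in> wt V 0" "b \<in> wt V 0"
  shows "ring_elem (a \<oplus>\<^bsub>V\<^esub> b) = ring_elem a \<oplus>\<^bsub>A\<^esub> ring_elem b"
  using iso_add[of "(a, \<zero>\<^bsub>V\<^esub>, filt0 V)" "(b, \<zero>\<^bsub>V\<^esub>, filt0 V)"] assms
  by (simp add: gr_wt_carrier[of 0] weight0_in gr_add_exact iso_weight0 wt_closure courant_simps)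

lemma ring_elem_smult:
  assumes "a \<in> wt V 0"
  shows "ring_elem (c \<odot>\<^bsub>V\<^esub> a) = c \<odot>\<^bsub>A\<^esub> ring_elem a"
  using iso_smult[of "(a, \<zero>\<^bsub>V\<^esub>, filt0 V)" c] assms
  by (simp add: gr_wt_carrier[of 0] weight0_in gr_add_exact iso_weight0 wt_closure courant_simps)

lemma ring_elem_mult:
  assumes "a \<in> wt V 0" "b \<in> wt V 0"
  shows "ring_elem (nprod V (-1) a b) = ring_elem a \<otimes>\<^bsub>A\<^esub> ring_elem b"
  using iso_nprod[of "-1" 0 0 "(a, \<zero>\<^bsub>V\<^esub>, filt0 V)" "(b, \<zero>\<^bsub>V\<^esub>, filt0 V)"] assms
  by (simp add: weight0_in gr_mult_weight0 iso_weight0 wt_closure)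
     (simp add: courant_of_def Let_def)

text \<open>
  Compatibility of the isomorphism with the products of weight 1 and weight 0: the action of \<open>v\<close> on
  functions is determined by the derivation that corresponds to the symbol of \<open>v\<close>.
\<close>

lemma ring_elem_action:
  assumes "\<omega> \<in> filt0 V" "v \<in> wt V 1" "a \<in> wt V 0"
    and "\<phi> (\<zero>\<^bsub>V\<^esub>, \<omega>, filt0 V +>\<^bsub>V\<^esub> v) = (b, \<tau>, \<eta>)" "\<tau> \<in> derivations A"
  shows "ring_elem (nprod V 0 v a) = \<tau> (ring_elem a)"
proof -
  have "\<tau> (ring_elem a) \<in> carrier A"
    using assms iso_weight0(2) by (auto simp: derivations_def)
  then show ?thesis
    using iso_nprod[of 0 1 0 "(\<zero>\<^bsub>V\<^esub>, \<omega>, filt0 V +>\<^bsub>V\<^esub> v)" "(a, \<zero>\<^bsub>V\<^esub>, filt0 V)"] assms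
    by (simp add: weight0_in weight1_in gr_action iso_weight0 wt_closure)
       (simp add: courant_of_def Let_def a_minus_def)
qed

lemma lift_derivation:
  assumes "\<tau> \<in> derivations A"
  obtains v where "v \<in> wt V 1" "\<And>a. a \<in> wt V 0 \<Longrightarrow> ring_elem (nprod V 0 v a) = \<tau> (ring_elem a)"
proof -
  have "\<zero>\<^bsub>kaehler A\<^esub> \<in> carrier (kaehler A)"
    using A.F.coset_eq_iff[OF A.submodule_kaehler_rels, of "\<zero>\<^bsub>free_mod A\<^esub>"]
      subgroup.one_closed[OF submodule.axioms(1)[OF A.submodule_kaehler_rels]]
    by (force simp: A.kaehler_zero A.kaehler_carrier)
  then have "(\<zero>\<^bsub>A\<^esub>, \<tau>, \<zero>\<^bsub>kaehler A\<^esub>) \<in> \<phi> ` wt (gr V) 1"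
    using assms by (simp add: iso_wt1 courant_simps)
  then obtain \<omega> v where "\<omega> \<in> filt0 V" "v \<in> wt V 1"
    "\<phi> (\<zero>\<^bsub>V\<^esub>, \<omega>, filt0 V +>\<^bsub>V\<^esub> v) = (\<zero>\<^bsub>A\<^esub>, \<tau>, \<zero>\<^bsub>kaehler A\<^esub>)"
    by (auto simp: gr_simps)
  then show ?thesis
    using that ring_elem_action assms by blast
qed

text \<open>
  An isomorphism of algebroids is only assumed to respect the weights, not the filtration.
  Nevertheless every Kaehler differential comes from \<open>F\<^sup>0\<close>, because \<open>\<Omega>(A)\<close> is generated by products
  \<open>a db\<close>, and \<open>\<phi>\<close> preserves products and \<open>T\<close>.
\<close>

lemma differential_is_exact:
  assumes "\<eta> \<in> carrier (kaehler A)"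
  shows "\<exists>\<omega>\<in>filt0 V. \<phi> (\<zero>\<^bsub>V\<^esub>, \<omega>, filt0 V) = (\<zero>\<^bsub>A\<^esub>, \<lambda>_. \<zero>\<^bsub>A\<^esub>, \<eta>)"
proof -
  have gen: "\<exists>\<omega>\<in>filt0 V. \<phi> (\<zero>\<^bsub>V\<^esub>, \<omega>, filt0 V) = (\<zero>\<^bsub>A\<^esub>, \<lambda>_. \<zero>\<^bsub>A\<^esub>, a \<odot>\<^bsub>kaehler A\<^esub> kd A b)"
    if ab: "a \<in> carrier A" "b \<in> carrier A" for a b
  proof -
    obtain a' where a': "a' \<in> wt V 0" "ring_elem a' = a" using ring_elem_surj[OF ab(1)] .
    obtain b' where b': "b' \<in> wt V 0" "ring_elem b' = b" using ring_elem_surj[OF ab(2)] .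
    have T: "transl V b' \<in> filt0 V"
      using filt0_generator[OF vac_wt b'(1)] vac_left[of 1 "-1" "transl V b'"] b'(1)
      by (simp add: mode_def wt_closure)
    have Tb: "\<phi> (\<zero>\<^bsub>V\<^esub>, transl V b', filt0 V) = (\<zero>\<^bsub>A\<^esub>, \<lambda>_. \<zero>\<^bsub>A\<^esub>, kd A b)"
      using iso_transl[of "(b', \<zero>\<^bsub>V\<^esub>, filt0 V)"] b' by (simp add: gr_simps iso_weight0 courant_simps)
    have "\<phi> (\<zero>\<^bsub>V\<^esub>, nprod V (-1) a' (transl V b'), filt0 V)
        = nprod (courant_of A) (-1) (a, \<lambda>_. \<zero>\<^bsub>A\<^esub>, \<zero>\<^bsub>kaehler A\<^esub>) (\<zero>\<^bsub>A\<^esub>, \<lambda>_. \<zero>\<^bsub>A\<^esub>, kd A b)"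
      using iso_nprod[of "-1" 0 1 "(a', \<zero>\<^bsub>V\<^esub>, filt0 V)" "(\<zero>\<^bsub>V\<^esub>, transl V b', filt0 V)"] a' T
      by (simp add: gr_mult_exact weight0_in exact_in iso_weight0 Tb)
    also have "\<dots> = (\<zero>\<^bsub>A\<^esub>, \<lambda>_. \<zero>\<^bsub>A\<^esub>, a \<odot>\<^bsub>kaehler A\<^esub> kd A b)"
      using ab
      by (simp add: courant_of_def Let_def A.kaehler_smult_zero A.kaehler_zero_right
          A.kaehler_smult_kd_carrier)
    finally show ?thesis
      using filt0_generator[OF a'(1) b'(1)] by blast
  qed
  show ?thesis
    using assms
  proof (induction rule: A.kaehler_induct)
    case zero
    have "\<zero>\<^bsub>A\<^esub> \<odot>\<^bsub>kaehler A\<^esub> kd A \<zero>\<^bsub>A\<^esub> = \<zero>\<^bsub>kaehler A\<^esub>"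
      using A.F.smult_l_null[OF A.free_gen_carrier[OF A.zero_closed]]
        A.F.coset_eq_iff[OF A.submodule_kaehler_rels, of "\<zero>\<^bsub>free_mod A\<^esub>"]
        subgroup.one_closed[OF submodule.axioms(1)[OF A.submodule_kaehler_rels]]
      by (simp add: kd_def A.kaehler_smult A.free_gen_carrier A.kaehler_zero)
    then show ?case using gen[of "\<zero>\<^bsub>A\<^esub>" "\<zero>\<^bsub>A\<^esub>"] by simp
  next
    case (add \<omega> \<eta>)
    then obtain \<omega>' \<eta>' where "\<omega>' \<in> filt0 V" "\<eta>' \<in> filt0 V"
      "\<phi> (\<zero>\<^bsub>V\<^esub>, \<omega>', filt0 V) = (\<zero>\<^bsub>A\<^esub>, \<lambda>_. \<zero>\<^bsub>A\<^esub>, \<omega>)" "\<phi> (\<zero>\<^bsub>V\<^esub>, \<eta>', filt0 V) = (\<zero>\<^bsub>A\<^esub>, \<lambda>_. \<zero>\<^bsub>A\<^esub>, \<eta>)"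
      by blast
    then show ?case
      using iso_add[of "(\<zero>\<^bsub>V\<^esub>, \<omega>', filt0 V)" "(\<zero>\<^bsub>V\<^esub>, \<eta>', filt0 V)"]
      by (intro bexI[of _ "\<omega>' \<oplus>\<^bsub>V\<^esub> \<eta>'"])
         (simp_all add: gr_wt_carrier[of 1] exact_in gr_add_exact courant_simps filt0_closed)
  qed (rule gen)
qed

text \<open>
  The quantization contains no more differentials than \<open>A\<close> has Kaehler differentials: the symbol of \<open>w\<close>
  has zero component in \<open>Der(A)\<close>, so it comes from \<open>\<Omega>(A)\<close>, and the preimage of \<open>\<Omega>(A)\<close> is the exact part.
\<close>

lemma acts_trivially_imp_exact:
  assumes "w \<in> wt V 1" "\<And>a. a \<in> wt V 0 \<Longrightarrow> nprod V 0 w a = \<zero>\<^bsub>V\<^esub>"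
  shows "w \<in> filt0 V"
proof -
  let ?C = "filt0 V +>\<^bsub>V\<^esub> w"
  have mem: "(\<zero>\<^bsub>V\<^esub>, \<zero>\<^bsub>V\<^esub>, ?C) \<in> wt (gr V) 1"
    by (rule weight1_in[OF filt0_zero assms(1)])
  then have "\<phi> (\<zero>\<^bsub>V\<^esub>, \<zero>\<^bsub>V\<^esub>, ?C) \<in> wt (courant_of A) 1"
    using iso_wt1 by blast
  then obtain \<tau> \<eta> where \<phi>: "\<phi> (\<zero>\<^bsub>V\<^esub>, \<zero>\<^bsub>V\<^esub>, ?C) = (\<zero>\<^bsub>A\<^esub>, \<tau>, \<eta>)"
    and \<tau>: "\<tau> \<in> derivations A" and \<eta>: "\<eta> \<in> carrier (kaehler A)"
    by (auto simp: courant_simps)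
  have fn0: "ring_elem \<zero>\<^bsub>V\<^esub> = \<zero>\<^bsub>A\<^esub>"
    using ring_elem_add[OF zero_wt zero_wt] iso_weight0(2)[OF zero_wt] by simp
  have "\<tau> b = \<zero>\<^bsub>A\<^esub>" if b: "b \<in> carrier A" for b
  proof -
    obtain a where "a \<in> wt V 0" "ring_elem a = b" using ring_elem_surj[OF b] .
    then show ?thesis
      using ring_elem_action[OF filt0_zero assms(1) _ \<phi> \<tau>] assms(2) fn0 by metis
  qed
  moreover have "\<tau> b = \<zero>\<^bsub>A\<^esub>" if "b \<notin> carrier A" for b
    using \<tau> that by (simp add: derivations_def)
  ultimately have "\<tau> = (\<lambda>_. \<zero>\<^bsub>A\<^esub>)" by blast
  moreover obtain \<omega> where \<omega>: "\<omega> \<in> filt0 V" "\<phi> (\<zero>\<^bsub>V\<^esub>, \<omega>, filt0 V) = (\<zero>\<^bsub>A\<^esub>, \<lambda>_. \<zero>\<^bsub>A\<^esub>, \<eta>)"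
    using differential_is_exact[OF \<eta>] by blast
  ultimately have "(\<zero>\<^bsub>V\<^esub>, \<zero>\<^bsub>V\<^esub>, ?C) = (\<zero>\<^bsub>V\<^esub>, \<omega>, filt0 V)"
    using \<phi> mem exact_in[OF \<omega>(1)] iso_bij gr_wt_carrier[of 1]
    by (intro inj_onD[OF bij_betw_imp_inj_on[OF iso_bij]]) auto
  then show ?thesis
    using coset_eq_iff[OF filt0_submodule, of w] assms(1) by (simp add: vsimps)
qed

end

section \<open>The obstruction at a point derivation\<close>

text \<open>
  Here \<open>\<theta>\<close> is a tangent vector of \<open>Spec A\<close> at the point \<open>\<epsilon>\<close>, \<open>f\<close> and \<open>g\<close> are functions
  that are zero at this point and have zero derivative along \<open>\<theta>\<close>, and \<open>D\<close> and \<open>E\<close> are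
  vector fields that vanish at this point and transport \<open>\<theta>\<close> in the same way.
  Pairing with \<open>D\<close> and with \<open>E\<close> then has the same effect under \<open>\<theta>\<close> on every \<open>a db\<close>, namely
  \<open>\<epsilon>(a) \<theta>(D b)\<close>.  If the relation \<open>f\<sigma> = g\<tau>\<close> is lifted to a quantization, the result is such a
  differential, and \<open>\<theta>\<close> of its pairing with \<open>D\<close> only sees the quantum correction.
\<close>

theorem no_quantization_if_obstructed:
  fixes A :: "(complex, 'a) module" and V :: "'v algebroid"
  assumes "algebra CC A"
    and f: "f \<in> carrier A" and g: "g \<in> carrier A"
    and \<sigma>: "\<sigma> \<in> derivations A" and \<tau>: "\<tau> \<in> derivations A"
    and relation: "\<And>x. x \<in> carrier A \<Longrightarrow> f \<otimes>\<^bsub>A\<^esub> \<sigma> x = g \<otimes>\<^bsub>A\<^esub> \<tau> x"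
    and theta_add: "\<And>x y. x \<in> carrier A \<Longrightarrow> y \<in> carrier A \<Longrightarrow> \<theta> (x \<oplus>\<^bsub>A\<^esub> y) = \<theta> x + \<theta> y"
    and theta_smult: "\<And>c x. x \<in> carrier A \<Longrightarrow> \<theta> (c \<odot>\<^bsub>A\<^esub> x) = c * \<theta> x"
    and theta_mult: "\<And>x y. x \<in> carrier A \<Longrightarrow> y \<in> carrier A \<Longrightarrow>
      \<theta> (x \<otimes>\<^bsub>A\<^esub> y) = \<epsilon> x * \<theta> y + \<epsilon> y * \<theta> x"
    and zero_f: "\<epsilon> f = 0" "\<theta> f = 0" and zero_g: "\<epsilon> g = 0" "\<theta> g = 0"
    and D: "D \<in> derivations A" "\<And>x. x \<in> carrier A \<Longrightarrow> \<epsilon> (D x) = 0"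
    and E: "E \<in> derivations A" "\<And>x. x \<in> carrier A \<Longrightarrow> \<epsilon> (E x) = 0"
    and agree: "\<And>x. x \<in> carrier A \<Longrightarrow> \<theta> (D x) = \<theta> (E x)"
    and obstruction: "\<theta> (\<sigma> (D f)) - \<theta> (\<tau> (D g)) \<noteq> \<theta> (\<sigma> (E f)) - \<theta> (\<tau> (E g))"
  shows "\<not> is_quantization V (courant_of A)"
proof
  assume "is_quantization V (courant_of A)"
  then obtain \<phi> where *: "vertex_algebroid V" "algebroid_iso (gr V) (courant_of A) \<phi>"
    unfolding is_quantization_def by blast
  interpret quantization V A \<phi>
    using * assms(1) by (intro quantization.intro complex_algebra.intro quantization_axioms.intro)
  obtain f' where f': "f' \<in> wt V 0" "ring_elem f' = f" using ring_elem_surj[OF f] .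
  obtain g' where g': "g' \<in> wt V 0" "ring_elem g' = g" using ring_elem_surj[OF g] .
  obtain s where s: "s \<in> wt V 1" "\<And>a. a \<in> wt V 0 \<Longrightarrow> ring_elem (nprod V 0 s a) = \<sigma> (ring_elem a)"
    using lift_derivation[OF \<sigma>] by blast
  obtain t where t: "t \<in> wt V 1" "\<And>a. a \<in> wt V 0 \<Longrightarrow> ring_elem (nprod V 0 t a) = \<tau> (ring_elem a)"
    using lift_derivation[OF \<tau>] by blast
  note closure = wt_closure f'(1) g'(1) s(1) t(1)
  \<comment> \<open>This element would be zero in the Courant algebroid; in \<open>V\<close> it is only a differential.\<close>
  define w where "w = nprod V (-1) f' s \<oplus>\<^bsub>V\<^esub> (- 1) \<odot>\<^bsub>V\<^esub> nprod V (-1) g' t"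
  have w: "w \<in> wt V 1"
    by (simp add: w_def closure)
  have "nprod V 0 w a = \<zero>\<^bsub>V\<^esub>" if a: "a \<in> wt V 0" for a
  proof -
    have "ring_elem (nprod V (-1) f' (nprod V 0 s a)) = ring_elem (nprod V (-1) g' (nprod V 0 t a))"
      using relation[of "ring_elem a"] a by (simp add: ring_elem_mult closure f' g' s t iso_weight0)
    then have "nprod V (-1) f' (nprod V 0 s a) = nprod V (-1) g' (nprod V 0 t a)"
      by (rule ring_elem_inject) (simp_all add: closure a)
    moreover have "nprod V 0 w a = nprod V 0 (nprod V (-1) f' s) a
        \<oplus>\<^bsub>V\<^esub> (- 1) \<odot>\<^bsub>V\<^esub> nprod V 0 (nprod V (-1) g' t) a"
      unfolding w_def
      using nprod_add_left[of 0 1 0 "nprod V (-1) f' s" "(- 1) \<odot>\<^bsub>V\<^esub> nprod V (-1) g' t" a]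
        nprod_smult_left[of 0 1 0 "nprod V (-1) g' t" a "- 1"] a
      by (simp add: closure)
    ultimately show ?thesis
      by (simp add: zero_mode_mult closure a vsimps r_neg)
  qed
  then have exact: "w \<in> filt0 V"
    by (rule acts_trivially_imp_exact[OF w])
  define L where "L = (\<lambda>a. \<theta> (ring_elem a))"
  have L_add: "L (a \<oplus>\<^bsub>V\<^esub> b) = L a + L b" if "a \<in> wt V 0" "b \<in> wt V 0" for a b
    using that by (simp add: L_def ring_elem_add theta_add iso_weight0)
  have L_smult: "L (c \<odot>\<^bsub>V\<^esub> a) = c * L a" if "a \<in> wt V 0" for c a
    using that by (simp add: L_def ring_elem_smult theta_smult iso_weight0)
  have L_diff: "L (a \<ominus>\<^bsub>V\<^esub> b) = L a - L b" if "a \<in> wt V 0" "b \<in> wt V 0" for a b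
    using L_add[OF that(1) wt_neg[OF that(2)]] L_smult[OF that(2), of "- 1"] that
    by (simp add: a_minus_def vsimps)
  have L_mult: "L (nprod V (-1) a b) = \<epsilon> (ring_elem a) * L b + \<epsilon> (ring_elem b) * L a"
    if "a \<in> wt V 0" "b \<in> wt V 0" for a b
    using that by (simp add: L_def ring_elem_mult theta_mult iso_weight0)
  have L_zero: "L \<zero>\<^bsub>V\<^esub> = 0"
    using L_smult[OF zero_wt, of 0] by (simp add: smult_zero_left)
  \<comment> \<open>The values \<open>d\<^sub>(\<^sub>1\<^sub>) s\<close> and \<open>d\<^sub>(\<^sub>1\<^sub>) t\<close> are unknown, but multiplied by \<open>f\<close> and \<open>g\<close> they are killed by \<open>\<theta>\<close>.\<close>
  have L_pair: "L (nprod V 1 d w) = \<theta> (\<tau> (\<chi> g)) - \<theta> (\<sigma> (\<chi> f))"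
    if d: "d \<in> wt V 1" "\<And>a. a \<in> wt V 0 \<Longrightarrow> ring_elem (nprod V 0 d a) = \<chi> (ring_elem a)" for d \<chi>
  proof -
    have "L (nprod V 1 d (nprod V (-1) f' s)) = - \<theta> (\<sigma> (\<chi> f))"
      by (simp add: one_mode_mult closure d L_diff L_mult)
         (simp add: L_def closure d f' s zero_f)
    moreover have "L (nprod V 1 d (nprod V (-1) g' t)) = - \<theta> (\<tau> (\<chi> g))"
      by (simp add: one_mode_mult closure d L_diff L_mult)
         (simp add: L_def closure d g' t zero_g)
    moreover have "nprod V 1 d w = nprod V 1 d (nprod V (-1) f' s)
        \<oplus>\<^bsub>V\<^esub> (- 1) \<odot>\<^bsub>V\<^esub> nprod V 1 d (nprod V (-1) g' t)"
      unfolding w_def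
      using nprod_add_right[of 1 1 1 d "nprod V (-1) f' s" "(- 1) \<odot>\<^bsub>V\<^esub> nprod V (-1) g' t"]
        nprod_smult_right[of 1 1 1 d "nprod V (-1) g' t" "- 1"] d
      by (simp add: closure)
    ultimately show ?thesis
      by (simp add: L_add L_smult closure d)
  qed
  obtain d where d: "d \<in> wt V 1" "\<And>a. a \<in> wt V 0 \<Longrightarrow> ring_elem (nprod V 0 d a) = D (ring_elem a)"
    using lift_derivation[OF D(1)] by blast
  obtain e where e: "e \<in> wt V 1" "\<And>a. a \<in> wt V 0 \<Longrightarrow> ring_elem (nprod V 0 e a) = E (ring_elem a)"
    using lift_derivation[OF E(1)] by blast
  have "L (nprod V 1 d w) = L (nprod V 1 e w)"
    using exact
  proof (induction rule: filt0_induct)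
    case zero
    show ?case
      using nprod_zero_right[of 1 1 1 d] nprod_zero_right[of 1 1 1 e] d(1) e(1) by simp
  next
    case (add \<omega> \<eta>)
    then show ?case
      using nprod_add_right[of 1 1 1 d \<omega> \<eta>] nprod_add_right[of 1 1 1 e \<omega> \<eta>] d(1) e(1)
      by (simp add: L_add closure)
  next
    case (smult c \<omega>)
    then show ?case
      using nprod_smult_right[of 1 1 1 d \<omega> c] nprod_smult_right[of 1 1 1 e \<omega> c] d(1) e(1)
      by (simp add: L_smult closure)
  next
    case (gen a b)
    have "L (nprod V 1 x (nprod V (-1) a (transl V b))) = \<epsilon> (ring_elem a) * \<theta> (\<chi> (ring_elem b))"
      if "x \<in> wt V 1" "\<And>a. a \<in> wt V 0 \<Longrightarrow> ring_elem (nprod V 0 x a) = \<chi> (ring_elem a)"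
        "\<And>x. x \<in> carrier A \<Longrightarrow> \<epsilon> (\<chi> x) = 0" for x \<chi>
    proof -
      have "nprod V 0 (transl V b) (nprod V 0 x a) = \<zero>\<^bsub>V\<^esub>"
        using gen that by (intro transl_zero_mode) (simp_all add: closure)
      then show ?thesis
        using gen that
        by (simp add: one_mode_mult one_mode_transl closure L_diff L_mult L_zero)
           (simp add: L_def that iso_weight0)
    qed
    from this[OF d D(2)] this[OF e E(2)] show ?case
      using agree[of "ring_elem b"] gen by (simp add: iso_weight0)
  qed
  then show False
    using L_pair[OF d] L_pair[OF e] obstruction by (metis minus_diff_eq)
qed

section \<open>Linear extension from monomials\<close>

abbreviation lookup where "lookup \<equiv> Poly_Mapping.lookup"
abbreviation keys where "keys \<equiv> Poly_Mapping.keys"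
abbreviation single where "single \<equiv> Poly_Mapping.single"

lemma poly_mapping_induct_keys [consumes 1, case_names zero add]:
  fixes q :: "'m \<Rightarrow>\<^sub>0 'b::comm_monoid_add"
  assumes "keys q \<subseteq> S" and "P 0"
    and "\<And>m c p. m \<in> S \<Longrightarrow> keys p \<subseteq> S \<Longrightarrow> P p \<Longrightarrow> P (single m c + p)"
  shows "P q"
proof -
  have *: "P (\<Sum>m\<in>F. single m (lookup q m)) \<and> keys (\<Sum>m\<in>F. single m (lookup q m)) \<subseteq> S"
    if "finite F" "F \<subseteq> S" for F
    using that
  proof (induction F rule: finite_induct)
    case (insert m F)
    then show ?case
      using keys_add[of "single m (lookup q m)" "\<Sum>m\<in>F. single m (lookup q m)"]
      by (auto intro!: assms(3) split: if_splits)
  qed (use assms(2) in auto)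
  have "(\<Sum>m\<in>keys q. single m (lookup q m)) = q"
    by (rule poly_mapping_eqI)
       (auto simp: lookup_sum lookup_single when_def in_keys_iff sum.delta)
  then show ?thesis using *[OF finite_keys assms(1)] by simp
qed

lemmas poly_mapping_induct = poly_mapping_induct_keys[OF subset_UNIV, case_names zero add]

text \<open>
  Evaluations, monomial substitutions and linear vector fields are all linear extensions of maps on
  monomials.  Their values are complex numbers or polynomials, so the scalars act through a ring
  homomorphism from the complex numbers: the identity, or the embedding of the constants.
\<close>

locale scalar_hom =
  fixes s :: "complex \<Rightarrow> 'b::comm_ring_1"
  assumes scalar_add: "s (a + b) = s a + s b"
    and scalar_mult: "s (a * b) = s a * s b"
    and scalar_one: "s 1 = 1"
begin

definition extend :: "('m \<Rightarrow> 'b) \<Rightarrow> ('m \<Rightarrow>\<^sub>0 complex) \<Rightarrow> 'b" where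
  "extend h p = (\<Sum>m\<in>keys p. s (lookup p m) * h m)"

lemma scalar_zero: "s 0 = 0"
  using scalar_add[of 0 0] by simp

lemma extend_zero: "extend h 0 = 0"
  by (simp add: extend_def)

lemma extend_superset:
  assumes "finite S" "keys p \<subseteq> S"
  shows "extend h p = (\<Sum>m\<in>S. s (lookup p m) * h m)"
  unfolding extend_def
  by (rule sum.mono_neutral_left) (use assms in \<open>auto simp: in_keys_iff scalar_zero\<close>)

lemma extend_add: "extend h (p + q) = extend h p + extend h q"
proof -
  have "keys (p + q) \<subseteq> keys p \<union> keys q" by (rule keys_add)
  then show ?thesis
    by (simp add: extend_superset[of "keys p \<union> keys q"] lookup_add scalar_add sum.distrib
        algebra_simps)
qed

lemma extend_single: "extend h (single m c) = s c * h m"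
  by (cases "c = 0") (simp_all add: extend_def scalar_zero)

lemma extend_minus: "extend h (p - q) = extend h p - extend h q"
  using extend_add[of h "p - q" q] by simp

lemma extend_sum: "extend h (sum f S) = (\<Sum>x\<in>S. extend h (f x))"
  by (induction S rule: infinite_finite_induct) (simp_all add: extend_zero extend_add)

lemma extend_mult:
  fixes h :: "'m::comm_monoid_add \<Rightarrow> 'b"
  assumes "\<And>m n. h (m + n) = h m * h n"
  shows "extend h (p * q) = extend h p * extend h q"
proof (induction p rule: poly_mapping_induct)
  case (add m c p)
  have "extend h (single m c * q) = s c * h m * extend h q"
    by (induction q rule: poly_mapping_induct)
       (simp_all add: extend_zero extend_add extend_single distrib_left mult_single
         scalar_mult assms algebra_simps)
  with add show ?case
    by (simp add: distrib_right extend_add extend_single)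
qed (simp add: extend_zero)

lemma extend_scalar:
  fixes h :: "'m::comm_monoid_add \<Rightarrow> 'b"
  shows "extend h (single 0 c * p) = s c * extend h p"
  by (induction p rule: poly_mapping_induct)
     (simp_all add: extend_zero extend_add extend_single distrib_left mult_single
         scalar_mult algebra_simps)

end

interpretation number: scalar_hom "\<lambda>c. c"
  by unfold_locales simp_all

interpretation const: scalar_hom "single (0 :: 'm::comm_monoid_add) :: complex \<Rightarrow> _"
  by unfold_locales (simp_all add: single_add mult_single)

lemma poly_eval_extend: "poly_eval v = number.extend (\<lambda>m. prod_mset (image_mset v m))"
  by (simp add: fun_eq_iff poly_eval_def number.extend_def)

text \<open>
  The homomorphism \<open>y\<^sub>M \<mapsto> x\<^sup>M\<close>: a monomial in the indeterminates \<open>y\<^sub>M\<close> is a multiset of multisets, and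
  its image is their sum.
\<close>

definition monomial_subst :: "('x multiset multiset \<Rightarrow>\<^sub>0 complex) \<Rightarrow> ('x multiset \<Rightarrow>\<^sub>0 complex)" where
  "monomial_subst = const.extend (\<lambda>M. single (\<Sum>\<^sub># M) 1)"

lemma monomial_subst_single: "monomial_subst (single M c) = single (\<Sum>\<^sub># M) c"
  by (simp add: monomial_subst_def const.extend_single mult_single)

lemma monomial_subst_simps:
  "monomial_subst 0 = 0"
  "monomial_subst (p + q) = monomial_subst p + monomial_subst q"
  "monomial_subst (p - q) = monomial_subst p - monomial_subst q"
  "monomial_subst (sum f S) = (\<Sum>x\<in>S. monomial_subst (f x))"
  "monomial_subst (single {#} c * p) = single {#} c * monomial_subst p"
  using const.extend_scalar[of "\<lambda>M. single (\<Sum>\<^sub># M) 1" c p]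
  by (simp_all add: monomial_subst_def const.extend_zero const.extend_add const.extend_minus
      const.extend_sum)

lemma monomial_subst_mult: "monomial_subst (p * q) = monomial_subst p * monomial_subst q"
  unfolding monomial_subst_def by (rule const.extend_mult) (simp add: mult_single)

lemma prod_mset_sum_mset:
  "prod_mset (image_mset (\<lambda>M. prod_mset (image_mset l M)) P) = prod_mset (image_mset l (\<Sum>\<^sub># P))"
  by (induction P) simp_all

text \<open>
  The point of the Veronese cone over \<open>l\<close> has the coordinates \<open>l\<^sup>M\<close>, so evaluating there amounts to
  substituting monomials and evaluating at \<open>l\<close>.
\<close>

lemma poly_eval_monomial_subst:
  "poly_eval l (monomial_subst p) = poly_eval (\<lambda>M. prod_mset (image_mset l M)) p"
  by (induction p rule: poly_mapping_induct)
     (simp_all add: poly_eval_extend number.extend_zero number.extend_add number.extend_single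
       monomial_subst_simps monomial_subst_single prod_mset_sum_mset)

lemma lookup_monomial_subst: "lookup (monomial_subst p) k = (\<Sum>M\<in>keys p. lookup p M when \<Sum>\<^sub># M = k)"
  by (simp add: monomial_subst_def const.extend_def lookup_sum mult_single lookup_single)

section \<open>Polynomials vanishing at all nonzero points\<close>

lemma digits_unique:
  fixes a b :: "nat \<Rightarrow> nat"
  assumes "(\<Sum>i<n. a i * K ^ i) = (\<Sum>i<n. b i * K ^ i)"
    and "\<And>i. i < n \<Longrightarrow> a i < K" "\<And>i. i < n \<Longrightarrow> b i < K" and "i < n"
  shows "a i = b i"
  using assms
proof (induction n arbitrary: a b i)
  case (Suc n)
  have shift: "(\<Sum>i<Suc n. c i * K ^ i) = c 0 + K * (\<Sum>i<n. c (Suc i) * K ^ i)" for c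
    by (subst sum.lessThan_Suc_shift) (simp add: sum_distrib_left algebra_simps)
  have K: "a 0 < K" "b 0 < K" using Suc.prems(2,3)[of 0] by auto
  have eq: "a 0 + K * (\<Sum>i<n. a (Suc i) * K ^ i) = b 0 + K * (\<Sum>i<n. b (Suc i) * K ^ i)"
    using Suc.prems(1) by (simp only: shift)
  from arg_cong[OF eq, of "\<lambda>x. x mod K"] K have 0: "a 0 = b 0" by simp
  with eq K have eq': "(\<Sum>i<n. a (Suc i) * K ^ i) = (\<Sum>i<n. b (Suc i) * K ^ i)" by simp
  show ?case
  proof (cases i)
    case (Suc i')
    then show ?thesis
      using Suc.IH[OF eq', of i'] Suc.prems(2-4) by simp
  qed (simp add: 0)
qed simp

lemma prod_mset_power: "prod_mset (image_mset (\<lambda>i. t ^ w i) m) = (t :: 'a::comm_semiring_1) ^ sum_mset (image_mset w m)"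
  by (induction m) (simp_all add: power_add)

lemma sum_mset_weight:
  fixes w :: "nat \<Rightarrow> nat"
  assumes "set_mset m \<subseteq> {..<n}"
  shows "sum_mset (image_mset w m) = (\<Sum>i<n. count m i * w i)"
  using assms
proof (induction m)
  case (add x m)
  have "(\<Sum>i<n. count (add_mset x m) i * w i) = (\<Sum>i<n. count m i * w i + (if i = x then w x else 0))"
    by (rule sum.cong) auto
  with add show ?case by (simp add: sum.distrib)
qed simp

text \<open>
  Kronecker substitution: at \<open>l i = t ^ (K ^ i)\<close>, with \<open>K\<close> larger than all exponents, distinct monomials become
  distinct powers of \<open>t\<close>.  So \<open>q\<close> becomes a polynomial in one variable with the same coefficients, and
  it vanishes at all \<open>t \<noteq> 0\<close>.
\<close>

lemma poly_identity:
  fixes q :: "nat multiset \<Rightarrow>\<^sub>0 complex"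
  assumes "\<And>m. m \<in> keys q \<Longrightarrow> set_mset m \<subseteq> {..<n}" and "n > 0"
    and zero: "\<And>l. \<exists>i<n. l i \<noteq> 0 \<Longrightarrow> poly_eval l q = 0"
  shows "q = 0"
proof (rule ccontr)
  assume "q \<noteq> 0"
  define K where "K = Suc (Max (size ` keys q))"
  define wt where "wt = (\<lambda>m. sum_mset (image_mset (\<lambda>i. K ^ i) m))"
  define r :: "complex poly" where "r = (\<Sum>m\<in>keys q. monom (lookup q m) (wt m))"
  have size: "size m < K" if "m \<in> keys q" for m
    using that by (simp add: K_def less_Suc_eq_le)
  have inj: "m = m'" if "m \<in> keys q" "m' \<in> keys q" "wt m = wt m'" for m m'
  proof (rule multiset_eqI)
    fix i
    have cnt: "count x i < K" if "x \<in> keys q" for x i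
      using size[OF that] count_le_size[of x i] by simp
    show "count m i = count m' i"
    proof (cases "i < n")
      case True
      show ?thesis
        by (rule digits_unique[where n = n and K = K and a = "count m" and b = "count m'"])
           (use that cnt True assms(1) in \<open>simp_all add: wt_def sum_mset_weight[of _ n]\<close>)
    next
      case False
      then have "i \<notin># m" "i \<notin># m'" using assms(1) that by auto
      then show ?thesis by (simp add: not_in_iff)
    qed
  qed
  have "poly r t = 0" if "t \<noteq> 0" for t
  proof -
    have "poly_eval (\<lambda>i. t ^ (K ^ i)) q = 0"
      using assms(2) that by (intro zero) auto
    then show ?thesis
      by (simp add: r_def poly_sum poly_monom poly_eval_def wt_def prod_mset_power)
  qed
  then have "UNIV - {0} \<subseteq> {t. poly r t = 0}" by auto
  moreover have "infinite (UNIV - {0 :: complex})"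
    by (simp add: infinite_UNIV_char_0)
  ultimately have "r = 0"
    using poly_roots_finite[of r] finite_subset by blast
  obtain m where m: "m \<in> keys q" using \<open>q \<noteq> 0\<close> by (metis keys_eq_empty ex_in_conv)
  have "coeff r (wt m) = (\<Sum>m'\<in>keys q. if m' = m then lookup q m else 0)"
    unfolding r_def coeff_sum by (rule sum.cong) (use inj m in auto)
  also have "\<dots> = lookup q m" using m by simp
  finally show False using \<open>r = 0\<close> m by (simp add: in_keys_iff)
qed

section \<open>The Veronese ring as a ring of polynomials\<close>

definition veronese_polys :: "nat \<Rightarrow> nat \<Rightarrow> (nat multiset \<Rightarrow>\<^sub>0 complex) set" where
  "veronese_polys n N = {q. keys q \<subseteq> {m. set_mset m \<subseteq> {..<n} \<and> N dvd size m}}"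

lemma veronese_polys_add: "p \<in> veronese_polys n N \<Longrightarrow> q \<in> veronese_polys n N \<Longrightarrow> p + q \<in> veronese_polys n N"
  using keys_add[of p q] by (auto simp: veronese_polys_def)

lemma veronese_polys_single:
  "set_mset m \<subseteq> {..<n} \<Longrightarrow> N dvd size m \<Longrightarrow> single m c \<in> veronese_polys n N"
  by (auto simp: veronese_polys_def)

lemma veronese_polys_induct [consumes 1, case_names zero add]:
  assumes "q \<in> veronese_polys n N" "P 0"
    "\<And>m c p. set_mset m \<subseteq> {..<n} \<Longrightarrow> N dvd size m \<Longrightarrow> p \<in> veronese_polys n N \<Longrightarrow> P p \<Longrightarrow>
      P (single m c + p)"
  shows "P q"
  using assms(1) unfolding veronese_polys_def mem_Collect_eq
  by (induction q rule: poly_mapping_induct_keys) (use assms(2,3) in \<open>auto simp: veronese_polys_def\<close>)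

lemma keys_mult_subset:
  assumes "\<And>a b. a \<in> keys p \<Longrightarrow> b \<in> keys q \<Longrightarrow> a + b \<in> S"
  shows "keys (p * q) \<subseteq> S"
  using keys_mult[of p q] assms by blast

lemma poly_alg_carrier: "p \<in> carrier (poly_alg J) \<longleftrightarrow> keys p \<subseteq> {m. set_mset m \<subseteq> J}"
  by (auto simp: poly_alg_def)

lemma poly_alg_closed:
  assumes "p \<in> carrier (poly_alg J)" "q \<in> carrier (poly_alg J)"
  shows "p + q \<in> carrier (poly_alg J)" "p * q \<in> carrier (poly_alg J)" "- p \<in> carrier (poly_alg J)"
  using assms keys_add[of p q] keys_mult_subset[of p q "{m. set_mset m \<subseteq> J}"]
  by (auto simp: poly_alg_carrier)

lemma poly_alg_simps:
  "p \<oplus>\<^bsub>poly_alg J\<^esub> q = p + q" "p \<otimes>\<^bsub>poly_alg J\<^esub> q = p * q" "\<zero>\<^bsub>poly_alg J\<^esub> = 0" "\<one>\<^bsub>poly_alg J\<^esub> = 1"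
  "c \<odot>\<^bsub>poly_alg J\<^esub> p = single {#} c * p"
  by (simp_all add: poly_alg_def)

lemma algebra_poly_alg: "algebra CC (poly_alg J)"
proof -
  have units: "0 \<in> carrier (poly_alg J)" "1 \<in> carrier (poly_alg J)" "single {#} c \<in> carrier (poly_alg J)" for c
    by (auto simp: poly_alg_carrier)
  have "cring (poly_alg J)"
  proof (intro cringI abelian_groupI comm_monoidI)
    show "\<exists>q\<in>carrier (poly_alg J). q \<oplus>\<^bsub>poly_alg J\<^esub> p = \<zero>\<^bsub>poly_alg J\<^esub>" if "p \<in> carrier (poly_alg J)" for p
      using that poly_alg_closed(3)[OF that that] by (intro bexI[of _ "- p"]) (simp_all add: poly_alg_simps)
  qed (auto simp: poly_alg_simps poly_alg_closed units algebra_simps)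
  then show ?thesis
    by (intro algebraI cring_CC)
       (auto simp: poly_alg_simps poly_alg_closed units algebra_simps single_add mult_single
         simp flip: mult.assoc)
qed

definition veronese_ideal :: "nat \<Rightarrow> nat \<Rightarrow> (nat multiset multiset \<Rightarrow>\<^sub>0 complex) set" where
  "veronese_ideal n N = {p \<in> carrier (poly_alg (veronese_coords n N)). monomial_subst p = 0}"

lemma size_sum_veronese:
  "set_mset M \<subseteq> veronese_coords n N \<Longrightarrow> size (\<Sum>\<^sub># M) = N * size M"
  by (induction M) (auto simp: veronese_coords_def)

lemma set_sum_veronese:
  "set_mset M \<subseteq> veronese_coords n N \<Longrightarrow> set_mset (\<Sum>\<^sub># M) \<subseteq> {..<n}"
  by (induction M) (auto simp: veronese_coords_def)

lemma keys_monomial_subst: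
  assumes "p \<in> carrier (poly_alg (veronese_coords n N))"
  shows "keys (monomial_subst p) \<subseteq> {m. set_mset m \<subseteq> {..<n} \<and> N dvd size m}"
    (is "_ \<subseteq> ?S")
  using assms unfolding poly_alg_carrier
proof (induction p rule: poly_mapping_induct_keys)
  case (add M c p)
  then have M: "set_mset M \<subseteq> veronese_coords n N" by simp
  have "N dvd size (\<Sum>\<^sub># M)"
    unfolding size_sum_veronese[OF M] by simp
  then have "keys (single (\<Sum>\<^sub># M) c) \<subseteq> ?S"
    using set_sum_veronese[OF M] by auto
  with add keys_add[of "single (\<Sum>\<^sub># M) c" "monomial_subst p"] show ?case
    by (simp add: monomial_subst_simps monomial_subst_single) blast
qed (simp add: monomial_subst_simps)

text \<open>
  A homogeneous polynomial that vanishes on the Veronese variety is mapped to a polynomial that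
  vanishes at all nonzero points.  Conversely, the substitution multiplies degrees by \<open>N\<close>, so it
  respects the decomposition into homogeneous components, and the components of a polynomial in its
  kernel lie in the kernel.
\<close>

lemma genideal_eq_veronese_ideal:
  assumes "n > 0" "N > 0"
  shows "Idl\<^bsub>poly_alg (veronese_coords n N)\<^esub> {p \<in> carrier (poly_alg (veronese_coords n N)).
           homogeneous p \<and> (\<forall>z\<in>veronese_image n. poly_eval z p = 0)} = veronese_ideal n N"
    (is "Idl\<^bsub>?P\<^esub> ?G = _")
proof -
  interpret P: algebra CC ?P by (rule algebra_poly_alg)
  have "ideal (veronese_ideal n N) ?P"
  proof (rule idealI)
    show "subgroup (veronese_ideal n N) (add_monoid ?P)"
    proof (rule P.add.subgroupI)
      show "\<ominus>\<^bsub>?P\<^esub> p \<in> veronese_ideal n N" if "p \<in> veronese_ideal n N" for p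
      proof -
        have "\<ominus>\<^bsub>?P\<^esub> p = - p"
          using that poly_alg_closed(3)[of p] P.minus_equality[of "- p" p]
          by (auto simp: veronese_ideal_def poly_alg_simps)
        then show ?thesis
          using that poly_alg_closed(3)[of p] monomial_subst_simps(3)[of 0 p]
          by (auto simp: veronese_ideal_def monomial_subst_simps)
      qed
    qed (auto simp: veronese_ideal_def poly_alg_simps monomial_subst_simps poly_alg_closed
        intro: exI[of _ 0] simp: poly_alg_carrier[of 0])
  qed (auto simp: P.ring_axioms veronese_ideal_def poly_alg_simps monomial_subst_mult poly_alg_closed)
  moreover have "?G \<subseteq> veronese_ideal n N"
  proof
    fix p assume p: "p \<in> ?G"
    have "monomial_subst p = 0"
    proof (rule poly_identity)
      show "set_mset m \<subseteq> {..<n}" if "m \<in> keys (monomial_subst p)" for m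
        using keys_monomial_subst[of p n N] p that by blast
      show "poly_eval l (monomial_subst p) = 0" if "\<exists>i<n. l i \<noteq> 0" for l
        using p that by (auto simp: poly_eval_monomial_subst veronese_image_def)
    qed fact
    then show "p \<in> veronese_ideal n N" using p by (simp add: veronese_ideal_def)
  qed
  ultimately have "Idl\<^bsub>?P\<^esub> ?G \<subseteq> veronese_ideal n N"
    by (rule P.genideal_minimal)
  moreover have "veronese_ideal n N \<subseteq> Idl\<^bsub>?P\<^esub> ?G"
  proof
    fix p assume "p \<in> veronese_ideal n N"
    then have p: "p \<in> carrier ?P" "monomial_subst p = 0" by (auto simp: veronese_ideal_def)
    interpret I: ideal "Idl\<^bsub>?P\<^esub> ?G" ?P by (rule P.genideal_ideal) auto
    define comp where "comp = (\<lambda>d. \<Sum>M\<in>{M\<in>keys p. size M = d}. single M (lookup p M))"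
    have lookup_comp: "lookup (comp d) M = (if size M = d then lookup p M else 0)" for d M
      by (auto simp: comp_def lookup_sum lookup_single when_def in_keys_iff sum.delta)
    have keys_comp: "keys (comp d) = {M \<in> keys p. size M = d}" for d
      by (auto simp: in_keys_iff lookup_comp split: if_splits)
    have "monomial_subst (comp d) = 0" for d
    proof (rule poly_mapping_eqI)
      fix k
      have "lookup (monomial_subst (comp d)) k
          = (\<Sum>M\<in>keys p. if size M = d \<and> \<Sum>\<^sub># M = k then lookup p M else 0)"
        unfolding lookup_monomial_subst keys_comp
        by (rule sum.mono_neutral_cong_left) (auto simp: lookup_comp when_def)
      also have "\<dots> = (if size k = N * d then lookup (monomial_subst p) k else 0)"
      proof -
        have "size M = d \<and> \<Sum>\<^sub># M = k \<longleftrightarrow> size k = N * d \<and> \<Sum>\<^sub># M = k" if "M \<in> keys p" for M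
          using size_sum_veronese[of M n N] p(1) that \<open>N > 0\<close> by (auto simp: poly_alg_carrier)
        then have "(\<Sum>M\<in>keys p. if size M = d \<and> \<Sum>\<^sub># M = k then lookup p M else 0)
            = (\<Sum>M\<in>keys p. if size k = N * d \<and> \<Sum>\<^sub># M = k then lookup p M else 0)"
          by (intro sum.cong) simp_all
        then show ?thesis
          unfolding lookup_monomial_subst by (simp add: when_def)
      qed
      finally show "lookup (monomial_subst (comp d)) k = lookup 0 k" by (simp add: p(2))
    qed
    moreover have comp_carrier: "comp d \<in> carrier ?P" for d
      using p(1) by (auto simp: poly_alg_carrier keys_comp)
    ultimately have "comp d \<in> ?G" for d
      by (auto simp: homogeneous_def keys_comp veronese_image_def simp flip: poly_eval_monomial_subst)
         (simp add: poly_eval_def)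
    then have comp: "comp d \<in> Idl\<^bsub>?P\<^esub> ?G" for d
      using P.genideal_self[of ?G] by auto
    have sum_in: "(\<Sum>d\<in>D. comp d) \<in> Idl\<^bsub>?P\<^esub> ?G" if "finite D" for D
      using that
    proof (induction D rule: finite_induct)
      case empty
      then show ?case using I.zero_closed by (simp add: poly_alg_simps)
    next
      case (insert d D)
      then show ?case using I.a_closed[OF comp[of d] insert.IH] by (simp add: poly_alg_simps)
    qed
    have sum_eq: "(\<Sum>d\<in>size ` keys p. comp d) = p"
    proof (rule poly_mapping_eqI)
      fix M
      have "lookup p M = 0" if "size M \<notin> size ` keys p"
        using that by (metis image_eqI in_keys_iff)
      then show "lookup (\<Sum>d\<in>size ` keys p. comp d) M = lookup p M"
        by (simp add: lookup_sum lookup_comp)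
    qed
    show "p \<in> Idl\<^bsub>?P\<^esub> ?G"
      using sum_in[of "size ` keys p"] by (simp add: sum_eq)
  qed
  ultimately show ?thesis by blast
qed

lemma veronese_monomial_exists:
  assumes "set_mset m \<subseteq> {..<n}" "size m = N * d"
  shows "\<exists>M. set_mset M \<subseteq> veronese_coords n N \<and> \<Sum>\<^sub># M = m"
  using assms
proof (induction d arbitrary: m)
  case 0
  then show ?case by (intro exI[of _ "{#}"]) simp
next
  case (Suc d)
  obtain xs where xs: "mset xs = m" using ex_mset by blast
  define a where "a = mset (take N xs)"
  have a: "a \<subseteq># m" "size a = N"
    using Suc.prems(2) xs mset_subset_eq_add_left[of a "mset (drop N xs)"]
    by (auto simp: a_def simp flip: mset_append)
  have "set_mset (m - a) \<subseteq> {..<n}" "size (m - a) = N * d"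
    using Suc.prems a by (auto simp: size_Diff_submset dest: in_diffD)
  from Suc.IH[OF this] obtain M where M: "set_mset M \<subseteq> veronese_coords n N" "\<Sum>\<^sub># M = m - a"
    by blast
  have "a \<in> veronese_coords n N"
    using a Suc.prems(1) by (auto simp: veronese_coords_def dest: mset_subset_eqD)
  with M a show ?case
    by (intro exI[of _ "add_mset a M"]) (simp add: subset_mset.add_diff_inverse)
qed

lemma monomial_subst_surj:
  assumes "q \<in> veronese_polys n N"
  shows "\<exists>p\<in>carrier (poly_alg (veronese_coords n N)). monomial_subst p = q"
  using assms
proof (induction rule: veronese_polys_induct)
  case zero
  then show ?case by (intro bexI[of _ 0]) (auto simp: monomial_subst_simps poly_alg_carrier)
next
  case (add m c q)
  then obtain p where p: "p \<in> carrier (poly_alg (veronese_coords n N))" "monomial_subst p = q" by blast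
  from add obtain M where M: "set_mset M \<subseteq> veronese_coords n N" "\<Sum>\<^sub># M = m"
    using veronese_monomial_exists by (metis dvdE)
  then have "single M c \<in> carrier (poly_alg (veronese_coords n N))"
    by (auto simp: poly_alg_carrier)
  with M p show ?case
    by (intro bexI[of _ "single M c + p"])
       (auto simp: monomial_subst_simps monomial_subst_single poly_alg_closed)
qed

text \<open>
  The substitution of monomials identifies the homogeneous coordinate ring with the invariants of the
  group of \<open>N\<close>-th roots of unity in the polynomial ring.
\<close>

lemma veronese_ring_model:
  assumes "n > 0" "N > 0"
  obtains \<Phi> where "algebra CC (veronese_ring n N)"
    and "bij_betw \<Phi> (carrier (veronese_ring n N)) (veronese_polys n N)"
    and "\<And>x y. x \<in> carrier (veronese_ring n N) \<Longrightarrow> y \<in> carrier (veronese_ring n N) \<Longrightarrow>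
        \<Phi> (x \<oplus>\<^bsub>veronese_ring n N\<^esub> y) = \<Phi> x + \<Phi> y"
    and "\<And>x y. x \<in> carrier (veronese_ring n N) \<Longrightarrow> y \<in> carrier (veronese_ring n N) \<Longrightarrow>
        \<Phi> (x \<otimes>\<^bsub>veronese_ring n N\<^esub> y) = \<Phi> x * \<Phi> y"
    and "\<And>c x. x \<in> carrier (veronese_ring n N) \<Longrightarrow>
        \<Phi> (c \<odot>\<^bsub>veronese_ring n N\<^esub> x) = single {#} c * \<Phi> x"
proof -
  let ?P = "poly_alg (veronese_coords n N)" and ?I = "veronese_ideal n N"
  interpret P: algebra CC ?P by (rule algebra_poly_alg)
  have ring: "veronese_ring n N = quot_mod ?P ?I"
    by (simp add: veronese_ring_def homog_coord_ring_def genideal_eq_veronese_ideal[OF assms])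
  have ideal: "ideal ?I ?P"
    unfolding genideal_eq_veronese_ideal[OF assms, symmetric] by (rule P.genideal_ideal) auto
  note sub = P.ideal_imp_submodule[OF ideal]
  interpret I: ideal ?I ?P by (rule ideal)
  define \<Phi> where "\<Phi> = (\<lambda>C. monomial_subst (SOME p. p \<in> C) :: nat multiset \<Rightarrow>\<^sub>0 complex)"
  have \<Phi>: "\<Phi> (?I +>\<^bsub>?P\<^esub> p) = monomial_subst p" if "p \<in> carrier ?P" for p
  proof -
    define q where "q = (SOME q. q \<in> ?I +>\<^bsub>?P\<^esub> p)"
    have "q \<in> ?I +>\<^bsub>?P\<^esub> p"
      unfolding q_def by (rule someI) (rule I.a_rcos_self[OF that])
    then obtain u where u: "u \<in> ?I" "q = u + p"
      unfolding a_r_coset_def' poly_alg_simps by blast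
    have "\<Phi> (?I +>\<^bsub>?P\<^esub> p) = monomial_subst q"
      unfolding \<Phi>_def q_def ..
    also have "\<dots> = monomial_subst u + monomial_subst p"
      unfolding u(2) by (rule monomial_subst_simps)
    also have "monomial_subst u = 0"
      using u(1) unfolding veronese_ideal_def by blast
    finally show ?thesis by simp
  qed
  have carrier: "carrier (veronese_ring n N) = (\<lambda>p. ?I +>\<^bsub>?P\<^esub> p) ` carrier ?P"
    unfolding ring by (rule P.carrier_quot_mod[OF sub])
  have inj: "?I +>\<^bsub>?P\<^esub> p = ?I +>\<^bsub>?P\<^esub> q"
    if "p \<in> carrier ?P" "q \<in> carrier ?P" "monomial_subst p = monomial_subst q" for p q
  proof -
    have "p - q \<in> ?I"
      unfolding veronese_ideal_def mem_Collect_eq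
      using poly_alg_closed(1)[OF that(1) poly_alg_closed(3)[OF that(2,2)]] that(3)
      by (metis diff_conv_add_uminus eq_iff_diff_eq_0 monomial_subst_simps(3))
    then have "p \<in> ?I +>\<^bsub>?P\<^esub> q"
      unfolding a_r_coset_def' poly_alg_simps by (metis (no_types, lifting) UN_iff diff_add_cancel singletonI)
    then show ?thesis
      using I.a_repr_independence' that by metis
  qed
  have smult_P: "single {#} c * p \<in> carrier ?P" if "p \<in> carrier ?P" for c p
    using P.smult_closed[of c p] that by (simp add: poly_alg_simps)
  have hom: "\<Phi> ((?I +>\<^bsub>?P\<^esub> p) \<oplus>\<^bsub>veronese_ring n N\<^esub> (?I +>\<^bsub>?P\<^esub> q)) = \<Phi> (?I +>\<^bsub>?P\<^esub> p) + \<Phi> (?I +>\<^bsub>?P\<^esub> q)"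
    "\<Phi> ((?I +>\<^bsub>?P\<^esub> p) \<otimes>\<^bsub>veronese_ring n N\<^esub> (?I +>\<^bsub>?P\<^esub> q)) = \<Phi> (?I +>\<^bsub>?P\<^esub> p) * \<Phi> (?I +>\<^bsub>?P\<^esub> q)"
    "\<Phi> (c \<odot>\<^bsub>veronese_ring n N\<^esub> (?I +>\<^bsub>?P\<^esub> p)) = single {#} c * \<Phi> (?I +>\<^bsub>?P\<^esub> p)"
    if "p \<in> carrier ?P" "q \<in> carrier ?P" for c p q
    using that P.smult_quot_mod[OF sub, of c p]
    by (simp_all add: ring P.add_quot_mod[OF sub] P.mult_quot_mod[OF ideal]
        \<Phi> poly_alg_simps poly_alg_closed smult_P monomial_subst_simps monomial_subst_mult
        monomial_subst_single)
  show ?thesis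
  proof (rule that)
    show "algebra CC (veronese_ring n N)"
      unfolding ring by (rule P.algebra_quot_mod[OF ideal])
    have "inj_on \<Phi> (carrier (veronese_ring n N))"
    proof (rule inj_onI)
      fix C C' assume "C \<in> carrier (veronese_ring n N)" "C' \<in> carrier (veronese_ring n N)" "\<Phi> C = \<Phi> C'"
      moreover from this obtain p q where pq: "p \<in> carrier ?P" "q \<in> carrier ?P"
        and "C = ?I +>\<^bsub>?P\<^esub> p" "C' = ?I +>\<^bsub>?P\<^esub> q"
        unfolding carrier by blast
      ultimately show "C = C'" using inj[OF pq] \<Phi>[OF pq(1)] \<Phi>[OF pq(2)] by metis
    qed
    moreover have "\<Phi> ` carrier (veronese_ring n N) = veronese_polys n N"
    proof
      have "\<Phi> (?I +>\<^bsub>?P\<^esub> p) \<in> veronese_polys n N" if "p \<in> carrier ?P" for p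
        unfolding \<Phi>[OF that] veronese_polys_def using keys_monomial_subst[OF that] by blast
      then show "\<Phi> ` carrier (veronese_ring n N) \<subseteq> veronese_polys n N"
        unfolding carrier by blast
      show "veronese_polys n N \<subseteq> \<Phi> ` carrier (veronese_ring n N)"
        using monomial_subst_surj by (force simp: carrier \<Phi> image_image)
    qed
    ultimately show "bij_betw \<Phi> (carrier (veronese_ring n N)) (veronese_polys n N)"
      by (simp add: bij_betw_def)
  qed (use hom in \<open>auto simp: carrier\<close>)
qed

section \<open>Linear vector fields on the Veronese cone\<close>

text \<open>
  The vector field \<open>x\<^sub>i \<partial>/\<partial>x\<^sub>k\<close>.  The difference of multisets truncates, but where it does the
  coefficient is zero.
\<close>

definition polarization :: "'x \<Rightarrow> 'x \<Rightarrow> ('x multiset \<Rightarrow>\<^sub>0 complex) \<Rightarrow> ('x multiset \<Rightarrow>\<^sub>0 complex)" where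
  "polarization i k = const.extend (\<lambda>m. single (m - {#k#} + {#i#}) (of_nat (count m k)))"

lemma polarization_single: "polarization i k (single m c) = single (m - {#k#} + {#i#}) (c * of_nat (count m k))"
  by (simp add: polarization_def const.extend_single mult_single)

lemma polarization_linear:
  "polarization i k 0 = 0"
  "polarization i k (p + q) = polarization i k p + polarization i k q"
  "polarization i k (single {#} c * p) = single {#} c * polarization i k p"
  using const.extend_scalar[of "\<lambda>m. single (m - {#k#} + {#i#}) (of_nat (count m k))" c p]
  by (simp_all add: polarization_def const.extend_zero const.extend_add)

lemma polarization_leibniz: "polarization i k (p * q) = p * polarization i k q + q * polarization i k p"
proof (induction p rule: poly_mapping_induct)
  case (add m c p)
  have "polarization i k (single m c * q) = single m c * polarization i k q + q * polarization i k (single m c)"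
  proof (induction q rule: poly_mapping_induct)
    case (add m' c' q)
    have 1: "single m c * polarization i k (single m' c')
        = single (m + m' - {#k#} + {#i#}) (c * c' * of_nat (count m' k))"
      by (cases "k \<in># m'") (simp_all add: polarization_single mult_single not_in_iff mult.assoc)
    have 2: "single m' c' * polarization i k (single m c)
        = single (m + m' - {#k#} + {#i#}) (c * c' * of_nat (count m k))"
      by (cases "k \<in># m") (simp_all add: polarization_single mult_single not_in_iff ac_simps)
    have "polarization i k (single m c * single m' c')
        = single (m + m' - {#k#} + {#i#}) (c * c' * of_nat (count m' k))
        + single (m + m' - {#k#} + {#i#}) (c * c' * of_nat (count m k))"
      by (simp add: mult_single polarization_single algebra_simps flip: single_add)
    with add 1 2 show ?case
      by (simp add: distrib_left distrib_right polarization_linear)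
  qed (simp add: polarization_linear)
  with add show ?case
    by (simp add: distrib_left distrib_right polarization_linear)
qed (simp add: polarization_linear)

lemma lookup_polarization: "lookup (polarization i i q) m = of_nat (count m i) * lookup q m"
proof (induction q rule: poly_mapping_induct)
  case (add m' c q)
  have "lookup (polarization i i (single m' c)) m = of_nat (count m i) * lookup (single m' c) m"
    by (cases "i \<in># m'") (auto simp: polarization_single lookup_single when_def not_in_iff)
  with add show ?case by (simp add: polarization_linear lookup_add distrib_left)
qed (simp add: polarization_linear)

text \<open>
  Both sides are \<open>x\<^sub>i x\<^sub>j x\<^sup>t \<partial>/\<partial>x\<^sub>k\<close>.
\<close>

lemma polarization_relation:
  "single (add_mset j t) 1 * polarization i k q = single (add_mset i t) 1 * polarization j k q"
proof (induction q rule: poly_mapping_induct)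
  case (add m c q)
  have "single (add_mset j t) 1 * polarization i k (single m c)
      = single (add_mset i t) 1 * polarization j k (single m c)"
    by (simp add: polarization_single mult_single add_mset_commute)
  with add show ?case by (simp add: polarization_linear distrib_left)
qed (simp add: polarization_linear)

lemma lookup_const_mult: "lookup (single {#} c * q) m = c * lookup q m"
proof (induction q rule: poly_mapping_induct)
  case (add m' c' q)
  then show ?case
    by (simp add: distrib_left lookup_add mult_single lookup_single when_def)
qed simp

lemma polarization_veronese_polys:
  assumes "q \<in> veronese_polys n N" "i < n"
  shows "polarization i k q \<in> veronese_polys n N"
  using assms(1)
proof (induction rule: veronese_polys_induct)
  case (add m c p)
  have "polarization i k (single m c) \<in> veronese_polys n N"
  proof (cases "k \<in># m")
    case True
    then have "size (m - {#k#} + {#i#}) = size m"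
      by (metis add_mset_add_single insert_DiffM size_add_mset)
    with add True assms(2) show ?thesis
      unfolding polarization_single
      by (intro veronese_polys_single) (auto dest: in_diffD)
  qed (simp add: polarization_single not_in_iff veronese_polys_def)
  with add show ?case by (simp add: polarization_linear veronese_polys_add)
qed (simp add: polarization_linear veronese_polys_def)

text \<open>
  Elements of the smallest positive degree are indecomposable, so their coefficients are point
  derivations at the vertex of the cone.
\<close>

lemma lookup_mult_degree_one:
  assumes "p \<in> veronese_polys n N" "q \<in> veronese_polys n N" and M: "size M = N" and N: "N > 0"
  shows "lookup (p * q) M = lookup p {#} * lookup q M + lookup q {#} * lookup p M"
  using assms(1)
proof (induction rule: veronese_polys_induct)
  case (add m c p)
  have "lookup (single m c * q) M = lookup (single m c) {#} * lookup q M + lookup q {#} * lookup (single m c) M"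
    using assms(2)
  proof (induction rule: veronese_polys_induct)
    case (add m' c' q)
    have "lookup (single m c * single m' c') M
        = lookup (single m c) {#} * lookup (single m' c') M + lookup (single m' c') {#} * lookup (single m c) M"
    proof (cases "m = {#} \<or> m' = {#}")
      case True
      then show ?thesis using M N by (auto simp: mult_single lookup_single when_def)
    next
      case False
      then have "size m \<ge> N" "size m' \<ge> N"
        using \<open>N dvd size m\<close> \<open>N dvd size m'\<close> by (auto intro!: dvd_imp_le simp: nonempty_has_size)
      then have "m + m' \<noteq> M" using M N by auto
      then show ?thesis using False by (simp add: mult_single lookup_single when_def)
    qed
    with add show ?case by (simp add: distrib_left distrib_right lookup_add)
  qed simp
  with add show ?case by (simp add: distrib_left distrib_right lookup_add)
qed simp

text \<open>
  Derivations of an algebra that is only isomorphic to a subring \<open>S\<close> of a commutative ring.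
\<close>

lemma transport_derivation:
  fixes A :: "(complex, 'a) module" and \<Phi> :: "'a \<Rightarrow> 'b::comm_ring_1"
  assumes "algebra CC A" and bij: "bij_betw \<Phi> (carrier A) S"
    and add: "\<And>x y. x \<in> carrier A \<Longrightarrow> y \<in> carrier A \<Longrightarrow> \<Phi> (x \<oplus>\<^bsub>A\<^esub> y) = \<Phi> x + \<Phi> y"
    and mult: "\<And>x y. x \<in> carrier A \<Longrightarrow> y \<in> carrier A \<Longrightarrow> \<Phi> (x \<otimes>\<^bsub>A\<^esub> y) = \<Phi> x * \<Phi> y"
    and smult: "\<And>c x. x \<in> carrier A \<Longrightarrow> \<Phi> (c \<odot>\<^bsub>A\<^esub> x) = s c * \<Phi> x"
    and closed: "\<And>p. p \<in> S \<Longrightarrow> \<delta> p \<in> S"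
    and additive: "\<And>p q. \<delta> (p + q) = \<delta> p + \<delta> q"
    and linear: "\<And>c p. \<delta> (s c * p) = s c * \<delta> p"
    and leibniz: "\<And>p q. \<delta> (p * q) = p * \<delta> q + q * \<delta> p"
  obtains D where "D \<in> derivations A" "\<And>x. x \<in> carrier A \<Longrightarrow> \<Phi> (D x) = \<delta> (\<Phi> x)"
proof -
  interpret complex_algebra A using assms(1) by (rule complex_algebra.intro)
  define D where "D = (\<lambda>x. if x \<in> carrier A then inv_into (carrier A) \<Phi> (\<delta> (\<Phi> x)) else \<zero>\<^bsub>A\<^esub>)"
  have in_image: "\<delta> (\<Phi> x) \<in> \<Phi> ` carrier A" if "x \<in> carrier A" for x
    using closed bij that by (auto simp: bij_betw_def)
  have D: "D x \<in> carrier A" "\<Phi> (D x) = \<delta> (\<Phi> x)" if "x \<in> carrier A" for x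
    using inv_into_into[OF in_image[OF that]] f_inv_into_f[OF in_image[OF that]] that
    by (simp_all add: D_def)
  have eqI: "x = y" if "\<Phi> x = \<Phi> y" "x \<in> carrier A" "y \<in> carrier A" for x y
    using that bij by (auto simp: bij_betw_def dest: inj_onD)
  have "D (c \<odot>\<^bsub>A\<^esub> x) = c \<odot>\<^bsub>A\<^esub> D x" if "x \<in> carrier A" for c x
    using that linear[of c "\<Phi> x"] by (intro eqI) (simp_all only: D smult smult_in)
  moreover have "D (x \<otimes>\<^bsub>A\<^esub> y) = (x \<otimes>\<^bsub>A\<^esub> D y) \<oplus>\<^bsub>A\<^esub> (y \<otimes>\<^bsub>A\<^esub> D x)"
    "D (x \<oplus>\<^bsub>A\<^esub> y) = D x \<oplus>\<^bsub>A\<^esub> D y" if "x \<in> carrier A" "y \<in> carrier A" for x y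
    using that by (auto intro!: eqI simp: D add mult additive leibniz)
  moreover have "D x = \<zero>\<^bsub>A\<^esub>" if "x \<notin> carrier A" for x
    using that by (simp add: D_def)
  ultimately have "D \<in> derivations A"
    using D(1) by (simp add: derivations_def)
  with D that show ?thesis by blast
qed

section \<open>Nonexistence of the quantization\<close>

theorem theorem5p3p1:
  fixes n N :: nat
  assumes "n > 2" and "N > 1"
  shows "\<not> (\<exists>\<V> :: 'v algebroid. is_quantization \<V> (courant_of (veronese_ring n N)))"
proof
  assume "\<exists>\<V> :: 'v algebroid. is_quantization \<V> (courant_of (veronese_ring n N))"
  then obtain \<V> :: "'v algebroid" where quant: "is_quantization \<V> (courant_of (veronese_ring n N))" ..
  let ?A = "veronese_ring n N"
  have pos: "n > 0" "N > 0" using assms by auto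
  obtain \<Phi> where alg: "algebra CC ?A" and bij: "bij_betw \<Phi> (carrier ?A) (veronese_polys n N)"
    and hom: "\<And>x y. x \<in> carrier ?A \<Longrightarrow> y \<in> carrier ?A \<Longrightarrow> \<Phi> (x \<oplus>\<^bsub>?A\<^esub> y) = \<Phi> x + \<Phi> y"
      "\<And>x y. x \<in> carrier ?A \<Longrightarrow> y \<in> carrier ?A \<Longrightarrow> \<Phi> (x \<otimes>\<^bsub>?A\<^esub> y) = \<Phi> x * \<Phi> y"
      "\<And>c x. x \<in> carrier ?A \<Longrightarrow> \<Phi> (c \<odot>\<^bsub>?A\<^esub> x) = single {#} c * \<Phi> x"
    by (rule veronese_ring_model[OF pos]) (rule that)
  interpret A: algebra CC ?A by fact
  have "\<exists>D\<in>derivations ?A. \<forall>x\<in>carrier ?A. \<Phi> (D x) = polarization i k (\<Phi> x)" if "i < n" for i k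
    by (rule transport_derivation[OF alg bij hom, of "polarization i k"])
       (blast intro: that polarization_linear polarization_veronese_polys polarization_leibniz)+
  then obtain D where D: "\<And>i k. i < n \<Longrightarrow> D i k \<in> derivations ?A"
    and \<Phi>_D: "\<And>i k x. i < n \<Longrightarrow> x \<in> carrier ?A \<Longrightarrow> \<Phi> (D i k x) = polarization i k (\<Phi> x)"
    by metis
  have D_closed: "D i k x \<in> carrier ?A" if "i < n" "x \<in> carrier ?A" for i k x
    using D[OF that(1), of k] that(2) by (auto simp: derivations_def)
  have \<Phi>_in: "\<Phi> x \<in> veronese_polys n N" if "x \<in> carrier ?A" for x
    using bij that by (auto simp: bij_betw_def)
  \<comment> \<open>The tail \<open>x\<^sub>2\<^bsup>N-1\<^esup>\<close> of the monomials \<open>f = x\<^sub>1 x\<^sub>2\<^bsup>N-1\<^esup>\<close> and \<open>g = x\<^sub>0 x\<^sub>2\<^bsup>N-1\<^esup>\<close>, which are \<open>m 1\<close> and \<open>m 0\<close> below.\<close>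
  define tail where "tail = replicate_mset (N - 1) (2::nat)"
  define M where "M = {#0, 1#} + replicate_mset (N - 2) (2::nat)"
  have size: "size tail = N - 1" "size M = N" using assms by (auto simp: tail_def M_def)
  have "\<exists>x\<in>carrier ?A. \<Phi> x = single (add_mset i tail) 1" if "i < n" for i
  proof -
    have "single (add_mset i tail) 1 \<in> veronese_polys n N"
      using that assms by (intro veronese_polys_single) (auto simp: size tail_def)
    then show ?thesis
      unfolding bij_betw_imp_surj_on[OF bij, symmetric] by force
  qed
  then obtain m where m: "\<And>i. i < n \<Longrightarrow> m i \<in> carrier ?A"
    "\<And>i. i < n \<Longrightarrow> \<Phi> (m i) = single (add_mset i tail) 1"
    by metis
  have lt: "0 < n" "1 < n" "2 < n" using assms by auto
  have cnt: "count tail 0 = 0" "count tail 1 = 0" "count tail 2 = N - 1"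
    "count M 0 = 1" "count M 1 = 1"
    by (auto simp: tail_def M_def)
  have ne: "add_mset 1 tail \<noteq> M" "add_mset 0 tail \<noteq> M"
    using cnt by (metis count_add_mset one_neq_zero zero_neq_one)+
  have tail_2: "tail = add_mset 2 (replicate_mset (N - 2) 2)"
    using assms by (cases N rule: nat.exhaust; cases "N - 1") (auto simp: tail_def)
  have "\<not> is_quantization \<V> (courant_of ?A)"
  proof (rule no_quantization_if_obstructed[OF alg, where f = "m 1" and g = "m 0"
        and \<sigma> = "D 0 2" and \<tau> = "D 1 2" and D = "D 1 1" and E = "D 0 0"
        and \<theta> = "\<lambda>x. lookup (\<Phi> x) M" and \<epsilon> = "\<lambda>x. lookup (\<Phi> x) {#}"])
    show "m 1 \<otimes>\<^bsub>?A\<^esub> D 0 2 x = m 0 \<otimes>\<^bsub>?A\<^esub> D 1 2 x" if x: "x \<in> carrier ?A" for x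
    proof (rule inj_onD[OF bij_betw_imp_inj_on[OF bij]])
      show "\<Phi> (m 1 \<otimes>\<^bsub>?A\<^esub> D 0 2 x) = \<Phi> (m 0 \<otimes>\<^bsub>?A\<^esub> D 1 2 x)"
        using x lt by (simp add: hom m D_closed \<Phi>_D polarization_relation)
    qed (use x lt in \<open>simp_all add: m D_closed A.m_closed\<close>)
    \<comment> \<open>Replacing one factor \<open>x\<^sub>2\<close> of \<open>f\<close> by \<open>x\<^sub>0\<close>, or one of \<open>g\<close> by \<open>x\<^sub>1\<close>, yields \<open>M\<close>; there are \<open>N - 1\<close> such factors.\<close>
    have "add_mset 0 (add_mset 1 tail - {#2#}) = M" "add_mset 1 (add_mset 0 tail - {#2#}) = M"
      by (simp_all add: tail_2 M_def)
    then have "lookup (\<Phi> (D 0 2 (D 1 1 (m 1)))) M = of_nat (N - 1)"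
      "lookup (\<Phi> (D 1 2 (D 1 1 (m 0)))) M = 0" "lookup (\<Phi> (D 0 2 (D 0 0 (m 1)))) M = 0"
      "lookup (\<Phi> (D 1 2 (D 0 0 (m 0)))) M = of_nat (N - 1)"
      using lt by (simp_all add: \<Phi>_D D_closed m polarization_single polarization_linear cnt cnt(2)[simplified])
    then show "lookup (\<Phi> (D 0 2 (D 1 1 (m 1)))) M - lookup (\<Phi> (D 1 2 (D 1 1 (m 0)))) M
        \<noteq> lookup (\<Phi> (D 0 2 (D 0 0 (m 1)))) M - lookup (\<Phi> (D 1 2 (D 0 0 (m 0)))) M"
      using assms(2) by (simp add: eq_neg_iff_add_eq_0 flip: of_nat_add)
    show "lookup (\<Phi> (x \<otimes>\<^bsub>?A\<^esub> y)) M = lookup (\<Phi> x) {#} * lookup (\<Phi> y) M + lookup (\<Phi> y) {#} * lookup (\<Phi> x) M"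
      if "x \<in> carrier ?A" "y \<in> carrier ?A" for x y
      using that lookup_mult_degree_one[OF \<Phi>_in \<Phi>_in size(2) pos(2)] by (simp add: hom)
    show "lookup (\<Phi> (c \<odot>\<^bsub>?A\<^esub> x)) M = c * lookup (\<Phi> x) M" if "x \<in> carrier ?A" for c x
      using that by (simp add: hom lookup_const_mult)
  qed (use lt ne in \<open>auto simp: m D D_closed \<Phi>_D hom lookup_add lookup_single lookup_polarization cnt cnt[simplified]\<close>)
  with quant show False by simp
qed

end
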